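(* Suppose that we have available a constant $R$ such that $\|\mathbf{x}_i\|_2\le R$ for all $i\in\{1,\ldots,n\}$. Consider running SGD on the logistic loss $L_n$ for a total of $k$ iterations, initialized at $\beta^0:=0$, with stochastic gradients computed by sampling observations independently and uniformly (with replacement), and using the constant step-size $$\bar\alpha:=\frac{\ln(2)}{R^2\sqrt{k+1}}.$$ Under Option B for the output $\hat\beta^k$, when the data is separable it holds for all $k\ge1$ that: (i) (margin bound) for any $\gamma\in(0,1]$, with probability at least $1-\gamma$ the normalized iterate $\bar\beta^k:=\hat\beta^k/\|\hat\beta^k\|_2$ satisfies $$\rho(\bar\beta^k)\ >\ \frac{\mathrm{DegSEP}^*\cdot\ln\Big(\frac{\mathrm{DegSEP}^*\sqrt{\gamma}\,\sqrt[4]{k+1}}{nR\sqrt{1.1}}-1\Big)}{2(\ln(k)+1)};$$ (ii) (shrinkage) $\|\hat\beta^k\|_2\le\dfrac{2\ln(k)}{\mathrm{DegSEP}^*}+\dfrac{2}{\|\mathbf{X}\|_{2,\infty}}$; and (iii) (expected gradient bound) $\mathbb{E}\big[\|\nabla L_n(\hat\beta^k)\|_2^2\big]<\dfrac{1.1\cdot R^2}{\sqrt{k+1}}$.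
   Context: Data: $\mathbf{x}_i\in\mathbb{R}^p$, $y_i\in\{-1,1\}$, $i=1,\ldots,n$; $\mathbf{X}\in\mathbb{R}^{n\times p}$ is the matrix whose $i$-th row is $\mathbf{x}_i$. The data is separable if there is $\beta\in\mathbb{R}^p$ with $y_i\beta^T\mathbf{x}_i>0$ for all $i$. Let $\ell(t):=\ln(1+\exp(-t))$ and $L_n(\beta):=\frac1n\sum_{i=1}^n\ell(y_i\beta^T\mathbf{x}_i)$. The margin is $\rho(\beta):=\min_{i\in\{1,\ldots,n\}}y_i\beta^T\mathbf{x}_i$, and (for the $\ell_2$ norm) $\mathrm{DegSEP}^*:=\max_{\|\beta\|_2\le1}\rho(\beta)$, which is positive when the data is separable. $\|\mathbf{X}\|_{2,\infty}:=\max_{\|\beta\|_2\le1}\|\mathbf{X}\beta\|_\infty=\max_i\|\mathbf{x}_i\|_2$. SGD with constant step-size $\bar\alpha$: at iteration $i\ge0$ draw an index $j_i$ uniformly from $\{1,\ldots,n\}$, independently of everything before, and set $\beta^{i+1}:=\beta^i-\bar\alpha\,\nabla_\beta\ell(y_{j_i}\beta^T\mathbf{x}_{j_i})|_{\beta=\beta^i}$. Option B: after $k$ iterations output $\hat\beta^k:=\beta^{I_k}$ where $I_k$ is a random variable distributed uniformly on $\{0,1,\ldots,k\}$, independent of $\beta^0,\ldots,\beta^k$. Expectation and probability are over all randomness in the algorithm. Convention: $\ln(a):=-\infty$ for $a\le0$. *)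

theory Defs
  imports "HOL-Probability.Probability"
begin

text \<open>
  The data set consists of the rows \<open>X $ i\<close> of a matrix \<open>X :: real ^ 'p ^ 'n\<close> together with
  labels \<open>y :: 'n \<Rightarrow> real\<close>, so that \<open>n = CARD('n)\<close> and \<open>p = CARD('p)\<close>.
\<close>

definition grad :: "('a::real_inner \<Rightarrow> real) \<Rightarrow> 'a \<Rightarrow> 'a" where
  "grad f x = (THE D. GDERIV f x :> D)"

lemma grad_eqI:
  fixes f :: "'a::real_inner \<Rightarrow> real"
  assumes "GDERIV f x :> D"
  shows "grad f x = D"
  unfolding grad_def
proof (rule the_equality)
  show "GDERIV f x :> D" by (fact assms)
  fix E assume "GDERIV f x :> E"
  with assms have "(\<lambda>h. h \<bullet> E) = (\<lambda>h. h \<bullet> D)"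
    unfolding gderiv_def by (rule has_derivative_unique[rotated])
  then have "(E - D) \<bullet> (E - D) = 0"
    by (metis inner_diff_right right_minus_eq)
  then show "E = D" by simp
qed

definition logistic :: "real \<Rightarrow> real" where
  "logistic t = ln (1 + exp (- t))"

definition sample_loss :: "real ^ 'p ^ 'n \<Rightarrow> ('n \<Rightarrow> real) \<Rightarrow> 'n \<Rightarrow> real ^ 'p \<Rightarrow> real" where
  "sample_loss X y i \<beta> = logistic (y i * (\<beta> \<bullet> X $ i))"

definition logistic_loss :: "real ^ 'p ^ 'n \<Rightarrow> ('n::finite \<Rightarrow> real) \<Rightarrow> real ^ 'p \<Rightarrow> real" where
  "logistic_loss X y \<beta> = (1 / real CARD('n)) * (\<Sum>i\<in>UNIV. sample_loss X y i \<beta>)"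

definition separable :: "real ^ 'p ^ 'n \<Rightarrow> ('n \<Rightarrow> real) \<Rightarrow> bool" where
  "separable X y \<longleftrightarrow> (\<exists>\<beta>. \<forall>i. y i * (\<beta> \<bullet> X $ i) > 0)"

definition margin :: "real ^ 'p ^ 'n \<Rightarrow> ('n::finite \<Rightarrow> real) \<Rightarrow> real ^ 'p \<Rightarrow> real" where
  "margin X y \<beta> = (MIN i. y i * (\<beta> \<bullet> X $ i))"

text \<open>
  The two maxima over the unit ball are written as suprema; the lemmas below show that they
  are attained.
\<close>

definition deg_sep :: "real ^ 'p ^ 'n \<Rightarrow> ('n::finite \<Rightarrow> real) \<Rightarrow> real" where
  "deg_sep X y = (SUP \<beta>\<in>{\<beta>. norm \<beta> \<le> 1}. margin X y \<beta>)"

definition norm_2_inf :: "real ^ 'p ^ 'n \<Rightarrow> real" where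
  "norm_2_inf X = (SUP \<beta>\<in>{\<beta>. norm \<beta> \<le> 1}. infnorm (X *v \<beta>))"

lemma SUP_unit_ball_attained:
  fixes f :: "real ^ 'p \<Rightarrow> real"
  assumes "continuous_on UNIV f"
  shows "\<exists>\<beta>. norm \<beta> \<le> 1 \<and> (SUP b\<in>{b. norm b \<le> 1}. f b) = f \<beta> \<and> (\<forall>b. norm b \<le> 1 \<longrightarrow> f b \<le> f \<beta>)"
proof -
  have eq: "{b :: real ^ 'p. norm b \<le> 1} = cball 0 1"
    by auto
  have "\<exists>\<beta>\<in>cball 0 1. \<forall>b\<in>cball 0 1. f b \<le> f \<beta>"
    by (rule continuous_attains_sup) (auto intro: continuous_on_subset[OF assms])
  then obtain \<beta> where \<beta>: "\<beta> \<in> cball 0 1" "\<forall>b\<in>cball 0 1. f b \<le> f \<beta>" by blast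
  then have "(SUP b\<in>cball 0 1. f b) = f \<beta>"
    by (intro cSup_eq_maximum) auto
  with \<beta> eq show ?thesis by auto
qed

lemma continuous_on_Min_inner:
  fixes X :: "real ^ 'p ^ 'n" and I :: "'n set"
  assumes "finite I" "I \<noteq> {}"
  shows "continuous_on UNIV (\<lambda>\<beta>. Min ((\<lambda>i. y i * (\<beta> \<bullet> X $ i)) ` I))"
  using assms
  by (induction I rule: finite_ne_induct) (auto intro!: continuous_intros continuous_on_min)

lemma deg_sep_attained:
  "\<exists>\<beta>. norm \<beta> \<le> 1 \<and> deg_sep X y = margin X y \<beta> \<and> (\<forall>b. norm b \<le> 1 \<longrightarrow> margin X y b \<le> margin X y \<beta>)"
  unfolding deg_sep_def margin_def
  by (intro SUP_unit_ball_attained continuous_on_Min_inner) auto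

lemma norm_2_inf_attained:
  "\<exists>\<beta>. norm \<beta> \<le> 1 \<and> norm_2_inf X = infnorm (X *v \<beta>)
     \<and> (\<forall>b. norm b \<le> 1 \<longrightarrow> infnorm (X *v b) \<le> infnorm (X *v \<beta>))"
  unfolding norm_2_inf_def
  by (intro SUP_unit_ball_attained continuous_on_infnorm matrix_vector_mult_linear_continuous_on)

text \<open>The logarithm with the convention \<open>ln a = -\<infinity>\<close> for \<open>a \<le> 0\<close>.\<close>

definition eln :: "real \<Rightarrow> ereal" where
  "eln a = (if a \<le> 0 then -\<infinity> else ereal (ln a))"

text \<open>\<open>j i\<close> is the index of the observation sampled in iteration \<open>i\<close>.\<close>

primrec sgd :: "real ^ 'p ^ 'n \<Rightarrow> ('n \<Rightarrow> real) \<Rightarrow> real \<Rightarrow> (nat \<Rightarrow> 'n) \<Rightarrow> nat \<Rightarrow> real ^ 'p" where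
  "sgd X y \<alpha> j 0 = 0"
| "sgd X y \<alpha> j (Suc i) =
     sgd X y \<alpha> j i - \<alpha> *\<^sub>R grad (sample_loss X y (j i)) (sgd X y \<alpha> j i)"

text \<open>
  The randomness of \<open>k\<close> iterations with output Option B. The index \<open>I\<close> takes values in
  \<open>{0..k}\<close> at every outcome, not just almost surely, so that only \<open>J 0, \<dots>, J (k - 1)\<close>
  matter and the output is a random variable. Independence of \<open>I\<close> and the iterates is
  independence of the generated sigma-algebras, because \<open>indep_var\<close> requires both random
  variables to have the same type.
\<close>

definition option_B ::
  "'w measure \<Rightarrow> real ^ 'p ^ 'n \<Rightarrow> ('n::finite \<Rightarrow> real) \<Rightarrow> real \<Rightarrow> nat
    \<Rightarrow> (nat \<Rightarrow> 'w \<Rightarrow> 'n) \<Rightarrow> ('w \<Rightarrow> nat) \<Rightarrow> bool" where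
  "option_B M X y \<alpha> k J I \<longleftrightarrow>
     prob_space M \<and>
     prob_space.indep_vars M (\<lambda>_. count_space UNIV) J {..<k} \<and>
     (\<forall>i<k. distr M (count_space UNIV) (J i) = uniform_count_measure UNIV) \<and>
     I \<in> measurable M (count_space {0..k}) \<and>
     distr M (count_space {0..k}) I = uniform_count_measure {0..k} \<and>
     prob_space.indep_set M
       (sets (vimage_algebra (space M) I (count_space {0..k})))
       (sets (vimage_algebra (space M)
          (\<lambda>\<omega>. \<lambda>i\<in>{0..k}. sgd X y \<alpha> (\<lambda>t. J t \<omega>) i) (PiM {0..k} (\<lambda>_. borel))))"

definition output_B ::
  "real ^ 'p ^ 'n \<Rightarrow> ('n \<Rightarrow> real) \<Rightarrow> real \<Rightarrow> (nat \<Rightarrow> 'w \<Rightarrow> 'n) \<Rightarrow> ('w \<Rightarrow> nat) \<Rightarrow> 'w \<Rightarrow> real ^ 'p" where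
  "output_B X y \<alpha> J I \<omega> = sgd X y \<alpha> (\<lambda>t. J t \<omega>) (I \<omega>)"

text \<open>The zero vector is its own normalization, since \<open>inverse 0 = 0\<close>.\<close>

definition normalized :: "real ^ 'p \<Rightarrow> real ^ 'p" where
  "normalized \<beta> = inverse (norm \<beta>) *\<^sub>R \<beta>"

end

theory Submission
  imports Defs
begin

text \<open>
  One SGD step decreases the loss in expectation by \<open>\<alpha> (norm (\<nabla>L))\<^sup>2\<close> up to \<open>\<alpha>\<^sup>2 R ^ 4 / 8\<close>, and
  telescoping gives the gradient bound. The distance of the iterates to \<open>(ln k / \<rho>) *\<^sub>R u\<close>, where \<open>u\<close>
  is the maximal margin direction and \<open>\<rho>\<close> its margin, hardly grows, which gives the shrinkage bound
  on every path. Since \<open>norm (\<nabla>L \<beta>) \<ge> \<rho> / (n (1 + exp (margin \<beta>)))\<close>, Markov's inequality for the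
  gradient bounds the margin of the output from below by \<open>ln (q - 1)\<close>, the logarithm in the theorem.

  Dividing by the norm of the output preserves this lower bound only if \<open>ln (q - 1) \<ge> 0\<close>. For
  \<open>1 < q < 2\<close> it is shown instead that the output has a negative margin with probability at most
  \<open>\<gamma>\<close>. Markov's inequality alone yields \<open>4 \<gamma>\<close>; the missing factor comes from the potential
  \<open>min (a L ^ 12) ((norm (\<beta> - (t / \<rho>) *\<^sub>R u))\<^sup>2 + B)\<close>, which decreases in expectation at every
  step and at a constant rate while the margin is negative.
\<close>

subsection \<open>The logistic function\<close>

definition sgm :: "real \<Rightarrow> real" where
  "sgm m = 1 / (1 + exp m)"

lemma one_plus_exp_pos [simp]: "0 < 1 + exp (m :: real)" "1 + exp (m :: real) \<noteq> 0"
  by (metis add_pos_pos exp_gt_zero zero_less_one) (metis add_pos_pos exp_gt_zero less_irrefl zero_less_one)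

lemma sgm_pos: "0 < sgm m" and sgm_less_1: "sgm m < 1"
  by (simp_all add: sgm_def divide_simps)

lemma sgm_antimono: "m \<le> m' \<Longrightarrow> sgm m' \<le> sgm m"
  unfolding sgm_def by (intro divide_left_mono) auto

lemma sgm_nonpos: "m \<le> 0 \<Longrightarrow> 1 / 2 \<le> sgm m"
  using sgm_antimono[of m 0] by (simp add: sgm_def)

lemma sgm_nonneg: "0 \<le> m \<Longrightarrow> sgm m \<le> 1 / 2"
  using sgm_antimono[of 0 m] by (simp add: sgm_def)

text \<open>Reduces comparisons of the loss with powers of the sigmoid to inequalities in the single
  variable \<open>s = sgm m\<close>.\<close>

lemma logistic_eq: "logistic m = - ln (1 - sgm m)"
proof -
  have "1 + exp (- m) = (1 + exp m) / exp m" 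
    by (simp add: exp_minus field_simps)
  moreover have "1 - sgm m = exp m / (1 + exp m)" 
    by (simp add: sgm_def field_simps)
  ultimately show ?thesis
    by (simp add: logistic_def ln_div)
qed

lemma logistic_pos: "0 < logistic m"
  unfolding logistic_def by (intro ln_gt_zero) simp

lemma logistic_antimono: "m \<le> m' \<Longrightarrow> logistic m' \<le> logistic m"
  by (simp add: logistic_def)

lemma logistic_le_exp: "logistic m \<le> exp (- m)"
  unfolding logistic_def using ln_add_one_self_le_self[of "exp (- m)"] by simp

lemma logistic_0: "logistic 0 = ln 2"
  by (simp add: logistic_def)

lemma sgm_le_logistic: "sgm m \<le> logistic m"
  using ln_le_minus_one[of "1 - sgm m"] sgm_less_1[of m] by (simp add: logistic_eq)

lemma logistic_nonpos: "m \<le> 0 \<Longrightarrow> ln 2 \<le> logistic m"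
  using logistic_antimono[of m 0] by (simp add: logistic_0)

lemma DERIV_logistic: "(logistic has_real_derivative - sgm m) (at m)"
proof -
  have "((\<lambda>m. ln (1 + exp (- m))) has_real_derivative - exp (- m) / (1 + exp (- m))) (at m)"
    by (auto intro!: derivative_eq_intros simp: add_pos_pos)
  moreover have "- exp (- m) / (1 + exp (- m)) = - sgm m"
    by (simp add: sgm_def exp_minus field_simps)
  ultimately show ?thesis
    by (simp add: logistic_def[abs_def])
qed

lemma DERIV_sgm: "(sgm has_real_derivative - (sgm m * (1 - sgm m))) (at m)"
proof -
  have "((\<lambda>m. 1 / (1 + exp m)) has_real_derivative - (sgm m * (1 - sgm m))) (at m)"
    by (auto intro!: derivative_eq_intros simp: sgm_def power2_eq_square field_simps)
  then show ?thesis
    by (simp add: sgm_def[abs_def])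
qed

lemma logistic_above_tangent: "logistic m - sgm m * (t - m) \<le> logistic t"
proof -
  have "convex_on UNIV logistic"
    by (rule f''_ge0_imp_convex[where f' = "\<lambda>m. - sgm m" and f'' = "\<lambda>m. sgm m * (1 - sgm m)"])
      (auto intro!: DERIV_logistic derivative_eq_intros DERIV_sgm
        simp: sgm_less_1 less_imp_le sgm_pos)
  from convex_on_imp_above_tangent[OF this, of m t "- sgm m"] show ?thesis
    using DERIV_logistic[of m] by simp
qed

text \<open>The second derivative \<open>s * (1 - s)\<close> of the loss is at most 1/4. Hence the
  gap \<open>?q\<close> is convex, and being stationary at \<open>m\<close> it attains its minimum
  there.\<close>

lemma logistic_descent: "logistic t \<le> logistic m - sgm m * (t - m) + (t - m)\<^sup>2 / 8"
proof -
  let ?q = "\<lambda>x. (x - m)\<^sup>2 / 8 - sgm m * (x - m) - logistic x"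
  have q: "(?q has_real_derivative (x - m) / 4 - sgm m + sgm x) (at x)" for x
    by (auto intro!: derivative_eq_intros DERIV_logistic)
  have "convex_on UNIV ?q"
  proof (rule f''_ge0_imp_convex[where f' = "\<lambda>x. (x - m) / 4 - sgm m + sgm x"
        and f'' = "\<lambda>x. 1 / 4 - sgm x * (1 - sgm x)"])
    fix x
    show "((\<lambda>x. (x - m) / 4 - sgm m + sgm x) has_real_derivative 1 / 4 - sgm x * (1 - sgm x)) (at x)"
      by (auto intro!: derivative_eq_intros DERIV_sgm)
    show "0 \<le> 1 / 4 - sgm x * (1 - sgm x)"
      using zero_le_power2[of "sgm x - 1 / 2"] by (simp add: power2_eq_square algebra_simps)
  qed (auto intro: q)
  from convex_on_imp_above_tangent[OF this, of m t 0] q[of m] show ?thesis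
    by simp
qed

lemma sgm_mult_diff_le: "sgm m * (m - t) \<le> logistic t - logistic m"
  using logistic_above_tangent[of m t] by (simp add: algebra_simps)

text \<open>The gap \<open>?g\<close> vanishes at 0 and its derivative is a square over
  \<open>1 - s\<close>. The coefficient 2 is the largest one for which this derivative is
  nonnegative on all of [0, 1).\<close>

lemma sgm_square_le: "(sgm m)\<^sup>2 \<le> logistic m / 2"
proof -
  let ?g = "\<lambda>s. - ln (1 - s) - 2 * s\<^sup>2 :: real"
  have "?g 0 \<le> ?g (sgm m)"
  proof (rule DERIV_nonneg_imp_nondecreasing[where f = ?g])
    show "0 \<le> sgm m" using sgm_pos[of m] by simp
    fix s assume s: "0 \<le> s" "s \<le> sgm m"
    with sgm_less_1[of m] have "s < 1" by simp
    then have "(?g has_real_derivative (1 / (1 - s) - 4 * s)) (at s)"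
      by (auto intro!: derivative_eq_intros)
    moreover have "1 / (1 - s) - 4 * s = (2 * s - 1)\<^sup>2 / (1 - s)"
      using \<open>s < 1\<close> by (simp add: power2_eq_square field_simps)
    ultimately show "\<exists>y. (?g has_real_derivative y) (at s) \<and> 0 \<le> y"
      using \<open>s < 1\<close> by auto
  qed
  then show ?thesis by (simp add: logistic_eq)
qed

text \<open>The maximum over \<open>m\<close> of the left-hand side is the least \<open>w\<close> satisfying the hypothesis.\<close>

lemma sgm_mult_diff_le':
  assumes "exp (- (1 + t + w)) \<le> w"
  shows "sgm m * (m - t) \<le> w"
proof -
  have w: "0 < w" using assms exp_gt_zero less_le_trans by blast
  have "- (1 + t + w) \<le> ln w"
    using assms w by (simp add: ln_ge_iff)
  \<comment> \<open>The tangent inequality of \<open>exp\<close> is used at \<open>m + ln w\<close>,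
    where \<open>exp\<close> equals \<open>w * exp m\<close>.\<close>
  moreover have "1 + (m + ln w) \<le> exp (m + ln w)"
    by (rule exp_ge_add_one_self)
  ultimately have "m - t \<le> w * (1 + exp m)"
    using w by (simp add: exp_add algebra_simps)
  then show ?thesis
    by (simp add: sgm_def field_simps)
qed

text \<open>For negative \<open>x\<close> one multiplies by \<open>exp (- x)\<close> and bounds that
  factor below by its quadratic Taylor polynomial. The product of the two polynomials is at least
  1.\<close>

lemma exp_le_quadratic:
  assumes "x \<le> (1 :: real)"
  shows "exp x \<le> 1 + x + x\<^sup>2"
proof (cases "0 \<le> x")
  case True
  with assms show ?thesis by (intro exp_bound)
next
  case False
  have "1 \<le> (1 + x + x\<^sup>2) * (1 + (- x) + (- x)\<^sup>2 / 2)"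
  proof -
    have "(1 + x + x\<^sup>2) * (1 + (- x) + (- x)\<^sup>2 / 2) = 1 + x\<^sup>2 / 2 - x * x\<^sup>2 / 2 + (x\<^sup>2)\<^sup>2 / 2"
      by (simp add: power2_eq_square field_simps)
    moreover have "x * x\<^sup>2 \<le> 0" using False by (simp add: mult_nonpos_nonneg)
    moreover have "0 \<le> x\<^sup>2" "0 \<le> (x\<^sup>2)\<^sup>2" by simp_all
    ultimately show ?thesis by linarith
  qed
  also have "\<dots> \<le> (1 + x + x\<^sup>2) * exp (- x)"
  proof (rule mult_left_mono)
    show "1 + (- x) + (- x)\<^sup>2 / 2 \<le> exp (- x)"
      using False by (intro exp_lower_Taylor_quadratic) simp
    have "0 \<le> (x + 1 / 2)\<^sup>2" by simp
    then show "0 \<le> 1 + x + x\<^sup>2" by (simp add: power2_eq_square algebra_simps)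
  qed
  finally show ?thesis
    by (simp add: exp_minus field_simps)
qed

subsection \<open>Loss and SGD steps\<close>

text \<open>Plays the role of the conditional expectation over one uniformly drawn index, given the
  past.\<close>

definition avg :: "('n::finite \<Rightarrow> real) \<Rightarrow> real" where
  "avg f = (\<Sum>i\<in>UNIV. f i) / real CARD('n)"

lemma square_norm_add: "(norm (x + y))\<^sup>2 = (norm x)\<^sup>2 + 2 * (x \<bullet> y) + (norm y)\<^sup>2"
  by (simp add: power2_norm_eq_inner inner_add_left inner_add_right inner_commute)

lemma avg_mono: "(\<And>i. f i \<le> g i) \<Longrightarrow> avg f \<le> avg g"
  by (simp add: avg_def divide_right_mono sum_mono)

lemma avg_const: "avg (\<lambda>_ :: 'n::finite. c) = c"
  by (simp add: avg_def)

lemma avg_add: "avg (\<lambda>i. f i + g i) = avg f + avg g"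
  by (simp add: avg_def sum.distrib add_divide_distrib)

lemma avg_cmult: "avg (\<lambda>i. c * f i) = c * avg f"
  by (simp add: avg_def sum_distrib_left[symmetric])

lemma avg_nonneg: "(\<And>i. 0 \<le> f i) \<Longrightarrow> 0 \<le> avg f"
  by (simp add: avg_def sum_nonneg)

lemma avg_ge_single:
  fixes f :: "'n::finite \<Rightarrow> real"
  assumes "\<And>i. 0 \<le> f i"
  shows "f j / real CARD('n) \<le> avg f"
  unfolding avg_def by (intro divide_right_mono member_le_sum) (auto simp: assms)

text \<open>Each value is at most \<open>n\<close> times the average, so one factor of each square
  can be replaced by \<open>n * avg f\<close>.\<close>

lemma avg_square_le:
  fixes f :: "'n::finite \<Rightarrow> real"
  assumes "\<And>i. 0 \<le> f i"
  shows "avg (\<lambda>i. (f i)\<^sup>2) \<le> real CARD('n) * (avg f)\<^sup>2"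
proof -
  have "(f i)\<^sup>2 \<le> real CARD('n) * avg f * f i" for i
    using mult_right_mono[OF avg_ge_single[of f i, OF assms] assms[of i]]
    by (simp add: field_simps power2_eq_square)
  then have "avg (\<lambda>i. (f i)\<^sup>2) \<le> avg (\<lambda>i. real CARD('n) * avg f * f i)"
    by (rule avg_mono)
  then show ?thesis
    unfolding avg_cmult by (simp add: power2_eq_square mult.assoc)
qed

text \<open>Absorbing the labels, \<open>z i\<close> stands for \<open>y i *\<^sub>R X $ i\<close>.\<close>

definition loss :: "('n::finite \<Rightarrow> 'a::real_inner) \<Rightarrow> 'a \<Rightarrow> real" where
  "loss z b = avg (\<lambda>i. logistic (b \<bullet> z i))"

definition loss_grad :: "('n::finite \<Rightarrow> 'a::real_inner) \<Rightarrow> 'a \<Rightarrow> 'a" where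
  "loss_grad z b = - ((1 / real CARD('n)) *\<^sub>R (\<Sum>i\<in>UNIV. sgm (b \<bullet> z i) *\<^sub>R z i))"

definition sgd_step :: "('n \<Rightarrow> 'a::real_inner) \<Rightarrow> real \<Rightarrow> 'a \<Rightarrow> 'n \<Rightarrow> 'a" where
  "sgd_step z \<alpha> b j = b + (\<alpha> * sgm (b \<bullet> z j)) *\<^sub>R z j"

lemma loss_grad_inner: "loss_grad z b \<bullet> v = - avg (\<lambda>i. sgm (b \<bullet> z i) * (v \<bullet> z i))"
  by (simp add: loss_grad_def avg_def inner_sum_right inner_commute[of _ v])

lemma avg_sgm_grad: "avg (\<lambda>j. sgm (b \<bullet> z j) * (loss_grad z b \<bullet> z j)) = - (norm (loss_grad z b))\<^sup>2"
  using loss_grad_inner[of z b "loss_grad z b"] by (simp add: power2_norm_eq_inner)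

lemma loss_pos: "0 < loss z b"
  unfolding loss_def avg_def by (intro divide_pos_pos sum_pos) (auto simp: logistic_pos)

lemma avg_sgm_pos: "0 < avg (\<lambda>i. sgm (b \<bullet> z i))"
  unfolding avg_def by (intro divide_pos_pos sum_pos) (auto simp: sgm_pos)

lemma avg_sgm_le_loss: "avg (\<lambda>i. sgm (b \<bullet> z i)) \<le> loss z b"
  unfolding loss_def by (intro avg_mono sgm_le_logistic)

lemma loss_0: "loss z 0 = ln 2"
  by (simp add: loss_def logistic_0 avg_const)

lemma loss_ge_if_neg:
  fixes z :: "'n::finite \<Rightarrow> 'a::real_inner"
  assumes "b \<bullet> z i < 0"
  shows "ln 2 / real CARD('n) \<le> loss z b"
proof -
  have "ln 2 / real CARD('n) \<le> logistic (b \<bullet> z i) / real CARD('n)"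
    using logistic_nonpos[of "b \<bullet> z i"] assms by (intro divide_right_mono) auto
  also have "\<dots> \<le> loss z b"
    unfolding loss_def by (rule avg_ge_single) (simp add: less_imp_le logistic_pos)
  finally show ?thesis .
qed

section \<open>One SGD step on data with a margin direction\<close>

text \<open>Collects what the one-step estimates use; \<open>u\<close> and \<rho> later become a
  direction of maximal margin and \<open>deg_sep X y\<close>.\<close>

locale margin_data =
  fixes z :: "'n::finite \<Rightarrow> 'a::real_inner" and R \<rho> :: real and u :: 'a
  assumes norm_z: "norm (z i) \<le> R"
    and norm_u: "norm u \<le> 1"
    and \<rho>_pos: "0 < \<rho>"
    and margin_u: "\<rho> \<le> u \<bullet> z i"
begin

lemma inner_z_le: "\<bar>v \<bullet> z i\<bar> \<le> norm v * R"
  using Cauchy_Schwarz_ineq2[of v "z i"] mult_left_mono[OF norm_z[of i], of "norm v"] by simp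

lemma \<rho>_le_R: "\<rho> \<le> R"
proof -
  have "0 \<le> R" using norm_z norm_ge_zero order_trans by blast
  then have "norm u * R \<le> 1 * R" by (intro mult_right_mono norm_u)
  with inner_z_le[of u undefined] margin_u[of undefined] show ?thesis by linarith
qed

lemma R_pos: "0 < R"
  using \<rho>_pos \<rho>_le_R by simp

lemma norm_z_square: "(norm (z i))\<^sup>2 \<le> R\<^sup>2"
  using norm_z by (simp add: power_mono)

text \<open>Averages \<open>logistic_descent\<close> over the samples; the change of each margin is
  at most \<open>norm v * R\<close>.\<close>

lemma loss_descent: "loss z (b + v) \<le> loss z b + loss_grad z b \<bullet> v + R\<^sup>2 * (norm v)\<^sup>2 / 8"
proof -
  have "logistic ((b + v) \<bullet> z i)
      \<le> logistic (b \<bullet> z i) + ((- 1) * (sgm (b \<bullet> z i) * (v \<bullet> z i)) + R\<^sup>2 * (norm v)\<^sup>2 / 8)" for i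
  proof -
    have "(v \<bullet> z i)\<^sup>2 \<le> (norm v * R)\<^sup>2"
      using inner_z_le[of v i] by (metis abs_ge_zero power2_abs power_mono)
    with logistic_descent[of "(b + v) \<bullet> z i" "b \<bullet> z i"] show ?thesis
      by (simp add: inner_add_left power_mult_distrib algebra_simps)
  qed
  then have "loss z (b + v) \<le> avg (\<lambda>i. logistic (b \<bullet> z i)
      + ((- 1) * (sgm (b \<bullet> z i) * (v \<bullet> z i)) + R\<^sup>2 * (norm v)\<^sup>2 / 8))"
    unfolding loss_def by (rule avg_mono)
  also have "\<dots> = loss z b + loss_grad z b \<bullet> v + R\<^sup>2 * (norm v)\<^sup>2 / 8"
    unfolding avg_add avg_cmult avg_const loss_grad_inner loss_def by simp
  finally show ?thesis .
qed

text \<open>The squared sigmoid is kept in the noise term: its average is at most \<open>n\<close>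
  times the squared average sigmoid, hence comparable with the squared gradient. The drift of the
  twelfth power depends on this.\<close>

lemma loss_sgd_step:
  "loss z (sgd_step z \<alpha> b j) \<le> loss z b
     + (\<alpha> * (sgm (b \<bullet> z j) * (loss_grad z b \<bullet> z j)) + \<alpha>\<^sup>2 * R ^ 4 / 8 * (sgm (b \<bullet> z j))\<^sup>2)"
proof -
  have "R\<^sup>2 * ((\<alpha> * sgm (b \<bullet> z j))\<^sup>2 * (norm (z j))\<^sup>2) \<le> R\<^sup>2 * ((\<alpha> * sgm (b \<bullet> z j))\<^sup>2 * R\<^sup>2)"
    by (intro mult_left_mono norm_z_square) auto
  also have "\<dots> = \<alpha>\<^sup>2 * R ^ 4 * (sgm (b \<bullet> z j))\<^sup>2"
    by (simp add: power_mult_distrib power4_eq_xxxx power2_eq_square)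
  finally show ?thesis
    using loss_descent[of b "(\<alpha> * sgm (b \<bullet> z j)) *\<^sub>R z j"]
    by (simp add: sgd_step_def power_mult_distrib mult.assoc)
qed

text \<open>The step is unbiased, so the linear term averages to minus \<alpha> times the squared
  gradient norm; in the noise term the sigmoid is bounded by 1.\<close>

lemma avg_loss_sgd_step:
  "avg (\<lambda>j. loss z (sgd_step z \<alpha> b j)) \<le> loss z b - \<alpha> * (norm (loss_grad z b))\<^sup>2 + \<alpha>\<^sup>2 * R ^ 4 / 8"
proof -
  have "avg (\<lambda>j. loss z (sgd_step z \<alpha> b j)) \<le> avg (\<lambda>j. loss z b
      + (\<alpha> * (sgm (b \<bullet> z j) * (loss_grad z b \<bullet> z j)) + \<alpha>\<^sup>2 * R ^ 4 / 8))"
  proof (rule avg_mono)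
    fix j
    have "(sgm (b \<bullet> z j))\<^sup>2 \<le> 1"
      using sgm_pos[of "b \<bullet> z j"] sgm_less_1[of "b \<bullet> z j"] by (simp add: power_le_one less_imp_le)
    then have "\<alpha>\<^sup>2 * R ^ 4 / 8 * (sgm (b \<bullet> z j))\<^sup>2 \<le> \<alpha>\<^sup>2 * R ^ 4 / 8 * 1"
      by (intro mult_left_mono) auto
    with loss_sgd_step[of \<alpha> b j]
    show "loss z (sgd_step z \<alpha> b j) \<le> loss z b
      + (\<alpha> * (sgm (b \<bullet> z j) * (loss_grad z b \<bullet> z j)) + \<alpha>\<^sup>2 * R ^ 4 / 8)" by simp
  qed
  also have "\<dots> = loss z b - \<alpha> * (norm (loss_grad z b))\<^sup>2 + \<alpha>\<^sup>2 * R ^ 4 / 8"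
    unfolding avg_add avg_const avg_cmult avg_sgm_grad by simp
  finally show ?thesis .
qed

text \<open>Test the gradient against \<open>u\<close>: all summands have the same sign and each is
  at least \<rho> times its weight.\<close>

lemma norm_loss_grad_ge: "\<rho> * avg (\<lambda>i. sgm (b \<bullet> z i)) \<le> norm (loss_grad z b)"
proof -
  have "\<rho> * avg (\<lambda>i. sgm (b \<bullet> z i)) \<le> avg (\<lambda>i. sgm (b \<bullet> z i) * (u \<bullet> z i))"
    unfolding avg_cmult[symmetric]
    by (intro avg_mono) (simp add: mult.commute mult_left_mono less_imp_le sgm_pos margin_u)
  also have "\<dots> = - (loss_grad z b \<bullet> u)" by (simp add: loss_grad_inner)
  also have "\<dots> \<le> norm (loss_grad z b) * norm u"
    using Cauchy_Schwarz_ineq2[of "loss_grad z b" u] by simp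
  also have "\<dots> \<le> norm (loss_grad z b)"
    using norm_u by (simp add: mult_left_le)
  finally show ?thesis .
qed

lemma norm_loss_grad_ge_sgm: "\<rho> * sgm (b \<bullet> z i) / real CARD('n) \<le> norm (loss_grad z b)"
proof -
  have "\<rho> * (sgm (b \<bullet> z i) / real CARD('n)) \<le> \<rho> * avg (\<lambda>i. sgm (b \<bullet> z i))"
    using \<rho>_pos by (intro mult_left_mono avg_ge_single[where f = "\<lambda>i. sgm (b \<bullet> z i)"])
      (auto simp: less_imp_le sgm_pos)
  with norm_loss_grad_ge[of b] show ?thesis by simp
qed

lemma norm_loss_grad_le: "norm (loss_grad z b) \<le> R * avg (\<lambda>i. sgm (b \<bullet> z i))"
proof -
  have "norm (\<Sum>i\<in>UNIV. sgm (b \<bullet> z i) *\<^sub>R z i) \<le> (\<Sum>i\<in>UNIV. R * sgm (b \<bullet> z i))"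
    by (intro sum_norm_le)
      (simp add: less_imp_le sgm_pos mult.commute mult_left_mono norm_z)
  then show ?thesis
    by (simp add: loss_grad_def avg_def sum_distrib_left[symmetric] divide_right_mono)
qed

text \<open>The perceptron recursion with comparator \<open>c *\<^sub>R u\<close>: expand the square
  and bound the comparator's margin on the drawn sample below by \<open>c * \<rho>\<close>.\<close>

lemma norm_sgd_step_diff:
  assumes "0 \<le> \<alpha>" "0 \<le> c"
  shows "(norm (sgd_step z \<alpha> b j - c *\<^sub>R u))\<^sup>2 \<le> (norm (b - c *\<^sub>R u))\<^sup>2
    + 2 * \<alpha> * (sgm (b \<bullet> z j) * (b \<bullet> z j - c * \<rho>) + \<alpha> * R\<^sup>2 / 2 * (sgm (b \<bullet> z j))\<^sup>2)"
proof -
  let ?s = "sgm (b \<bullet> z j)"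
  have "sgd_step z \<alpha> b j - c *\<^sub>R u = (b - c *\<^sub>R u) + (\<alpha> * ?s) *\<^sub>R z j"
    by (simp add: sgd_step_def)
  then have "(norm (sgd_step z \<alpha> b j - c *\<^sub>R u))\<^sup>2 = (norm (b - c *\<^sub>R u))\<^sup>2
      + 2 * \<alpha> * (?s * (b \<bullet> z j - c * (u \<bullet> z j))) + (\<alpha> * ?s)\<^sup>2 * (norm (z j))\<^sup>2"
    using square_norm_add[of "b - c *\<^sub>R u" "(\<alpha> * ?s) *\<^sub>R z j"]
    by (simp add: power_mult_distrib inner_diff_left algebra_simps)
  moreover have "(\<alpha> * ?s)\<^sup>2 * (norm (z j))\<^sup>2 \<le> (\<alpha> * ?s)\<^sup>2 * R\<^sup>2"
    by (intro mult_left_mono norm_z_square) auto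
  moreover have "2 * \<alpha> * (?s * (b \<bullet> z j - c * (u \<bullet> z j))) \<le> 2 * \<alpha> * (?s * (b \<bullet> z j - c * \<rho>))"
    using assms by (intro mult_left_mono diff_left_mono margin_u) (auto simp: less_imp_le sgm_pos)
  moreover have "2 * \<alpha> * (\<alpha> * R\<^sup>2 / 2 * ?s\<^sup>2) = (\<alpha> * ?s)\<^sup>2 * R\<^sup>2"
    by (simp add: power2_eq_square)
  ultimately show ?thesis unfolding distrib_left by linarith
qed

end

subsection \<open>A potential for the misclassified iterates\<close>

context margin_data
begin

text \<open>The thresholds \<open>0.079\<close> and \<open>0.0394\<close> are \<open>ln 2 / 8.8\<close> and \<open>ln 2 / 17.6\<close> rounded up, the extreme
  values for \<open>n = 2\<close> and \<open>2 * \<rho>\<^sup>2 = R\<^sup>2\<close>. In the remaining cases nothing is ever misclassified.\<close>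

lemma loss_power_sgd_step:
  assumes \<alpha>: "0 < \<alpha>" and small: "\<alpha> * R\<^sup>2 \<le> 0.079"
    and noise: "\<alpha> * R ^ 4 * real CARD('n) \<le> 8 * 0.0394 * \<rho>\<^sup>2"
    and noise': "\<alpha> * R ^ 3 * real CARD('n) \<le> 0.24 * \<rho>"
  shows "avg (\<lambda>j. loss z (sgd_step z \<alpha> b j) ^ 12)
    \<le> loss z b ^ 12 - 12 * 0.45 * \<alpha> * loss z b ^ 11 * (norm (loss_grad z b))\<^sup>2"
proof -
  define L where "L = loss z b"
  define G where "G = loss_grad z b"
  define s where "s j = sgm (b \<bullet> z j)" for j
  define v where "v j = \<alpha> * (s j * (G \<bullet> z j)) + \<alpha>\<^sup>2 * R ^ 4 / 8 * (s j)\<^sup>2" for j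
  define x where "x j = 12 / L * v j" for j
  have L: "0 < L" unfolding L_def by (rule loss_pos)
  have s: "0 < s j" "s j \<le> 1" for j
    unfolding s_def using sgm_pos sgm_less_1 less_imp_le by auto
  have S: "0 < avg s" "avg s \<le> L"
    using avg_sgm_pos avg_sgm_le_loss unfolding s_def L_def by auto
  have G_ge: "\<rho> * avg s \<le> norm G" and G_le: "norm G \<le> R * avg s"
    unfolding G_def s_def by (rule norm_loss_grad_ge norm_loss_grad_le)+
  have v_abs: "\<bar>v j\<bar> \<le> 1.03 * \<alpha> * R * norm G * s j" for j
  proof -
    have "\<bar>\<alpha> * (s j * (G \<bullet> z j))\<bar> \<le> \<alpha> * (s j * (norm G * R))"
      using inner_z_le[of G j] \<alpha> s[of j] by (simp add: abs_mult mult_left_mono)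
    then have "\<bar>\<alpha> * (s j * (G \<bullet> z j))\<bar> \<le> \<alpha> * R * norm G * s j"
      by (simp add: ac_simps)
    \<comment> \<open>The noise is at most 3 percent of the linear bound, since 0.24 / 8 = 0.03. One
      factor \<open>s j\<close> is turned into \<open>norm G\<close> by way of
      \<open>s j \<le> n * avg s\<close> and \<open>\<rho> * avg s \<le> norm G\<close>.\<close>
    moreover have "\<alpha>\<^sup>2 * R ^ 4 / 8 * (s j)\<^sup>2 \<le> 3 / 100 * (\<alpha> * R * norm G * s j)"
    proof -
      have "s j / real CARD('n) \<le> avg s"
        by (rule avg_ge_single) (simp add: s less_imp_le)
      then have "s j \<le> real CARD('n) * avg s" by (simp add: field_simps)
      then have "\<alpha> * R ^ 3 * s j \<le> \<alpha> * R ^ 3 * (real CARD('n) * avg s)"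
        using \<alpha> R_pos by (intro mult_left_mono) auto
      also have "\<dots> \<le> 0.24 * \<rho> * avg s"
        using mult_right_mono[OF noise', of "avg s"] S by simp
      also have "\<dots> \<le> 0.24 * norm G" using G_ge by simp
      finally have "\<alpha> * R ^ 3 * s j \<le> 0.24 * norm G" .
      then have "\<alpha> * R * s j / 8 * (\<alpha> * R ^ 3 * s j) \<le> \<alpha> * R * s j / 8 * (0.24 * norm G)"
        using \<alpha> R_pos s[of j] by (intro mult_left_mono) auto
      then show ?thesis by (simp add: power2_eq_square power3_eq_cube power4_eq_xxxx algebra_simps)
    qed
    moreover have "0 \<le> \<alpha>\<^sup>2 * R ^ 4 / 8 * (s j)\<^sup>2" by simp
    ultimately have "\<bar>v j\<bar> \<le> 103 / 100 * (\<alpha> * R * norm G * s j)"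
      unfolding v_def by linarith
    then show ?thesis by simp
  qed
  have G_le_L: "norm G \<le> R * L"
    using R_pos by (intro order_trans[OF G_le] mult_left_mono[OF S(2)]) simp
  \<comment> \<open>Needed for the quadratic bound on \<open>exp\<close>. The product 12 * 1.03 *
    0.079 lies just below 1, which limits the exponent of the potential to 12.\<close>
  have x_le_1: "x j \<le> 1" for j
  proof -
    have "\<bar>v j\<bar> \<le> 1.03 * \<alpha> * R * norm G * s j" by (rule v_abs)
    also have "\<dots> \<le> 1.03 * \<alpha> * R * (R * L) * 1"
      using \<alpha> R_pos s[of j] G_le_L L by (intro mult_mono) auto
    also have "\<dots> \<le> 1.03 * 0.079 * L"
      using mult_right_mono[OF small, of L] L by (simp add: power2_eq_square algebra_simps)
    also have "\<dots> \<le> L / 12" using L by simp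
    finally show ?thesis unfolding x_def using L by (simp add: field_simps)
  qed
  \<comment> \<open>From \<open>1 + v j / L \<le> exp (v j / L)\<close> the twelfth power becomes
    \<open>exp (x j)\<close>, which is then expanded to second order.\<close>
  have pow: "loss z (sgd_step z \<alpha> b j) ^ 12 \<le> L ^ 12 * (1 + x j + (x j)\<^sup>2)" for j
  proof -
    have "loss z (sgd_step z \<alpha> b j) \<le> L + v j"
      unfolding L_def G_def s_def v_def by (rule loss_sgd_step)
    also have "\<dots> = L * (1 + v j / L)" using L by (simp add: field_simps)
    also have "\<dots> \<le> L * exp (v j / L)"
      using L by (intro mult_left_mono exp_ge_add_one_self) auto
    finally have "loss z (sgd_step z \<alpha> b j) ^ 12 \<le> (L * exp (v j / L)) ^ 12"
      using loss_pos[of z] by (intro power_mono) (auto simp: less_imp_le)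
    also have "\<dots> = L ^ 12 * exp (x j)"
      by (simp add: power_mult_distrib x_def exp_of_nat_mult[symmetric])
    also have "\<dots> \<le> L ^ 12 * (1 + x j + (x j)\<^sup>2)"
      using L by (intro mult_left_mono exp_le_quadratic x_le_1) auto
    finally show ?thesis .
  qed
  \<comment> \<open>By \<open>noise\<close>, the first-order noise uses up a share 0.0394 of the
    expected decrease.\<close>
  have avg_x: "avg x \<le> 12 / L * (- (1 - 0.0394) * \<alpha> * (norm G)\<^sup>2)"
  proof -
    have x_eq: "avg x = 12 / L * (- \<alpha> * (norm G)\<^sup>2 + \<alpha>\<^sup>2 * R ^ 4 / 8 * avg (\<lambda>j. (s j)\<^sup>2))"
      using avg_sgm_grad[of b z] unfolding x_def v_def avg_cmult avg_add s_def G_def by simp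
    have "\<alpha>\<^sup>2 * R ^ 4 / 8 * avg (\<lambda>j. (s j)\<^sup>2) \<le> 0.0394 * \<alpha> * (norm G)\<^sup>2"
    proof -
      have "\<alpha> * R ^ 4 * avg (\<lambda>j. (s j)\<^sup>2) \<le> \<alpha> * R ^ 4 * (real CARD('n) * (avg s)\<^sup>2)"
        using \<alpha> avg_square_le[of s] s by (intro mult_left_mono) (auto simp: less_imp_le)
      also have "\<dots> \<le> 8 * 0.0394 * \<rho>\<^sup>2 * (avg s)\<^sup>2"
        using mult_right_mono[OF noise, of "(avg s)\<^sup>2"] by simp
      also have "\<dots> \<le> 8 * 0.0394 * (norm G)\<^sup>2"
        using power_mono[OF G_ge, of 2] \<rho>_pos S by (simp add: power_mult_distrib)
      finally have "\<alpha> / 8 * (\<alpha> * R ^ 4 * avg (\<lambda>j. (s j)\<^sup>2)) \<le> \<alpha> / 8 * (8 * 0.0394 * (norm G)\<^sup>2)"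
        using \<alpha> by (intro mult_left_mono) auto
      then show ?thesis by (simp add: power2_eq_square)
    qed
    then have "- \<alpha> * (norm G)\<^sup>2 + \<alpha>\<^sup>2 * R ^ 4 / 8 * avg (\<lambda>j. (s j)\<^sup>2)
        \<le> - (1 - 0.0394) * \<alpha> * (norm G)\<^sup>2"
      by (simp add: algebra_simps)
    then show ?thesis
      unfolding x_eq using L by (intro mult_left_mono) auto
  qed
  have avg_x2: "avg (\<lambda>j. (x j)\<^sup>2) \<le> 12 / L * (0.503 * \<alpha> * (norm G)\<^sup>2)"
  proof -
    have "avg (\<lambda>j. (x j)\<^sup>2) \<le> avg (\<lambda>j. (12 / L * (1.03 * \<alpha> * R * norm G))\<^sup>2 * (s j)\<^sup>2)"
    proof (rule avg_mono)
      fix j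
      have "\<bar>x j\<bar> \<le> 12 / L * (1.03 * \<alpha> * R * norm G * s j)"
        unfolding x_def abs_mult using L v_abs[of j] by (simp add: field_simps)
      from power_mono[OF this, of 2]
      show "(x j)\<^sup>2 \<le> (12 / L * (1.03 * \<alpha> * R * norm G))\<^sup>2 * (s j)\<^sup>2"
        by (simp add: power_mult_distrib power_divide mult.assoc)
    qed
    \<comment> \<open>One factor \<open>1 / L\<close> cancels because the mean squared sigmoid is at
      most \<open>L / 2\<close>. With \<open>small\<close>, the remaining coefficient
      \<open>12 * 1.03\<^sup>2 / 2 * 0.079\<close> is below 0.503.\<close>
    also have "\<dots> \<le> (12 / L * (1.03 * \<alpha> * R * norm G))\<^sup>2 * (L / 2)"
    proof -
      have "avg (\<lambda>j. (s j)\<^sup>2) \<le> avg (\<lambda>j. 1 / 2 * logistic (b \<bullet> z j))"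
        unfolding s_def using sgm_square_le by (intro avg_mono) simp
      then have "avg (\<lambda>j. (s j)\<^sup>2) \<le> L / 2"
        unfolding avg_cmult by (simp add: L_def loss_def)
      then show ?thesis unfolding avg_cmult by (intro mult_left_mono) auto
    qed
    also have "\<dots> = 12 / L * (12 * 1.03\<^sup>2 / 2 * (\<alpha> * R\<^sup>2) * (\<alpha> * (norm G)\<^sup>2))"
      using L by (simp add: power2_eq_square field_simps)
    also have "\<dots> \<le> 12 / L * (12 * 1.03\<^sup>2 / 2 * 0.079 * (\<alpha> * (norm G)\<^sup>2))"
      using L small \<alpha> by (intro mult_left_mono mult_right_mono) auto
    also have "\<dots> \<le> 12 / L * (0.503 * (\<alpha> * (norm G)\<^sup>2))"
      using L \<alpha> by (intro mult_left_mono mult_right_mono) (auto simp: power2_eq_square)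
    finally show ?thesis by (simp add: mult.assoc)
  qed
  have "avg (\<lambda>j. loss z (sgd_step z \<alpha> b j) ^ 12) \<le> L ^ 12 * (1 + avg x + avg (\<lambda>j. (x j)\<^sup>2))"
    using avg_mono[of "\<lambda>j. loss z (sgd_step z \<alpha> b j) ^ 12", OF pow]
    unfolding avg_cmult avg_add avg_const .
  \<comment> \<open>The remaining share is 1 - 0.0394 - 0.503 = 0.4576, rounded down to
    0.45.\<close>
  also have "\<dots> \<le> L ^ 12 * (1 - 12 / L * (0.45 * \<alpha> * (norm G)\<^sup>2))"
  proof (rule mult_left_mono)
    have "12 / L * (- (1 - 0.0394) * \<alpha> * (norm G)\<^sup>2) + 12 / L * (0.503 * \<alpha> * (norm G)\<^sup>2)
        = - (12 / L * (0.4576 * (\<alpha> * (norm G)\<^sup>2)))"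
      by (simp add: algebra_simps)
    moreover have "12 / L * (0.45 * (\<alpha> * (norm G)\<^sup>2)) \<le> 12 / L * (0.4576 * (\<alpha> * (norm G)\<^sup>2))"
      using L \<alpha> by (intro mult_left_mono mult_right_mono) auto
    ultimately show "1 + avg x + avg (\<lambda>j. (x j)\<^sup>2) \<le> 1 - 12 / L * (0.45 * \<alpha> * (norm G)\<^sup>2)"
      using avg_x avg_x2 by (simp only: mult.assoc)
  qed (use L in simp)
  also have "\<dots> = L ^ 12 - 12 * 0.45 * \<alpha> * L ^ 11 * (norm G)\<^sup>2"
    using L by (simp add: field_simps eval_nat_numeral)
  finally show ?thesis unfolding L_def G_def .
qed

text \<open>Far from the minimum the squared distance to \<open>(t / \<rho>) *\<^sub>R u\<close> decreases (as in the
  perceptron convergence proof), close to it the loss controls the misclassification. The high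
  power of the loss makes the second regime cheap; with a first power the constants would not
  suffice for small \<open>n\<close>.\<close>

definition potential :: "real \<Rightarrow> real \<Rightarrow> real \<Rightarrow> 'a \<Rightarrow> real" where
  "potential a B t b = min (a * loss z b ^ 12) ((norm (b - (t / \<rho>) *\<^sub>R u))\<^sup>2 + B)"

text \<open>The next potential is bounded by whichever branch of the minimum is active at
  \<open>b\<close>. The factor \<open>a\<close> makes the loss branch fall by exactly
  \<open>\<alpha> * \<kappa>\<close> at the least loss and gradient that a misclassification allows.
  The offset \<open>a * l ^ 12\<close> ensures that the distance branch is active only if the loss
  exceeds \<open>l\<close>, where the distance does not grow on average. In \<kappa>, one
  misclassified sample outweighs a gain of at most \<open>w\<close> from each of the others.\<close>

lemma avg_potential_sgd_step:
  fixes t w \<kappa> a l :: real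
  defines "\<kappa> \<equiv> 2 / real CARD('n) * ((t - 0.079 / 4) / 2 - (real CARD('n) - 1) * w)"
    and "a \<equiv> 4 * (real CARD('n))\<^sup>2 * \<kappa> / (12 * 0.45 * \<rho>\<^sup>2 * (ln 2 / real CARD('n)) ^ 11)"
    and "l \<equiv> logistic t / (1 - 0.079 / 4)"
  assumes \<alpha>: "0 < \<alpha>" and small: "\<alpha> * R\<^sup>2 \<le> 0.079"
    and noise: "\<alpha> * R ^ 4 * real CARD('n) \<le> 8 * 0.0394 * \<rho>\<^sup>2"
    and noise': "\<alpha> * R ^ 3 * real CARD('n) \<le> 0.24 * \<rho>"
    and t: "0.079 \<le> t" and w: "exp (- (1 + (t - 0.079 / 4) + w)) \<le> w"
    and \<kappa>: "0 < \<kappa>"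
  shows "avg (\<lambda>j. potential a (a * l ^ 12) t (sgd_step z \<alpha> b j))
    \<le> potential a (a * l ^ 12) t b - (if \<exists>i. b \<bullet> z i < 0 then \<alpha> * \<kappa> else 0)"
proof -
  let ?n = "real CARD('n)"
  let ?B = "a * l ^ 12"
  let ?bad = "\<exists>i. b \<bullet> z i < 0"
  let ?D = "(norm (b - (t / \<rho>) *\<^sub>R u))\<^sup>2"
  have w0: "0 < w" using w exp_gt_zero less_le_trans by blast
  have a: "0 < a" unfolding a_def using \<kappa> \<rho>_pos by (intro divide_pos_pos mult_pos_pos) auto
  have l: "0 < l" unfolding l_def by (simp add: logistic_pos)
  show ?thesis
  proof (cases "a * loss z b ^ 12 \<le> ?D + ?B")
    case True
    have "avg (\<lambda>j. potential a ?B t (sgd_step z \<alpha> b j))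
        \<le> avg (\<lambda>j. a * loss z (sgd_step z \<alpha> b j) ^ 12)"
      by (intro avg_mono) (simp add: potential_def)
    also have "\<dots> \<le> a * (loss z b ^ 12 - 12 * 0.45 * \<alpha> * loss z b ^ 11 * (norm (loss_grad z b))\<^sup>2)"
      unfolding avg_cmult using a loss_power_sgd_step[OF \<alpha> small noise noise']
      by (intro mult_left_mono) auto
    also have "\<dots> \<le> a * loss z b ^ 12 - (if ?bad then \<alpha> * \<kappa> else 0)"
    proof (cases ?bad)
      case bad: True
      then obtain i where i: "b \<bullet> z i < 0" by blast
      have "\<rho> / (2 * ?n) \<le> \<rho> * sgm (b \<bullet> z i) / ?n"
        using sgm_nonpos[of "b \<bullet> z i"] i \<rho>_pos by (simp add: field_simps)
      also have "\<dots> \<le> norm (loss_grad z b)" by (rule norm_loss_grad_ge_sgm)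
      finally have "(\<rho> / (2 * ?n))\<^sup>2 \<le> (norm (loss_grad z b))\<^sup>2"
        using \<rho>_pos by (intro power_mono) auto
      moreover have "(ln 2 / ?n) ^ 11 \<le> loss z b ^ 11"
        by (intro power_mono loss_ge_if_neg[of b z i, OF i]) auto
      ultimately have "(ln 2 / ?n) ^ 11 * (\<rho> / (2 * ?n))\<^sup>2
          \<le> loss z b ^ 11 * (norm (loss_grad z b))\<^sup>2"
        using loss_pos[of z b] by (intro mult_mono) auto
      then have "a * (12 * 0.45 * \<alpha>) * ((ln 2 / ?n) ^ 11 * (\<rho> / (2 * ?n))\<^sup>2)
          \<le> a * (12 * 0.45 * \<alpha>) * (loss z b ^ 11 * (norm (loss_grad z b))\<^sup>2)"
        using a \<alpha> by (intro mult_left_mono) auto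
      \<comment> \<open>This equation is what determines \<open>a\<close>.\<close>
      moreover have "a * (12 * 0.45 * \<alpha>) * ((ln 2 / ?n) ^ 11 * (\<rho> / (2 * ?n))\<^sup>2) = \<alpha> * \<kappa>"
      proof -
        have "(ln 2 / ?n) ^ 11 \<noteq> 0" by simp
        then show ?thesis
          unfolding a_def using \<rho>_pos
          by (simp add: field_simps del: power_divide) (simp add: power2_eq_square)
      qed
      ultimately have "\<alpha> * \<kappa> \<le> a * (12 * 0.45 * \<alpha> * loss z b ^ 11 * (norm (loss_grad z b))\<^sup>2)"
        by (simp only: mult.assoc)
      then show ?thesis unfolding if_P[OF bad] right_diff_distrib by linarith
    next
      case False
      have "0 \<le> a * (12 * 0.45 * \<alpha> * loss z b ^ 11 * (norm (loss_grad z b))\<^sup>2)"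
        using a \<alpha> loss_pos[of z b] by simp
      with False show ?thesis by (simp add: right_diff_distrib)
    qed
    also have "a * loss z b ^ 12 = potential a ?B t b"
      using True by (simp add: potential_def)
    finally show ?thesis .
  next
    case False
    \<comment> \<open>The bracket of \<open>norm_sgd_step_diff\<close> for
      \<open>c = t / \<rho>\<close>, with \<open>\<alpha> * R\<^sup>2\<close> replaced by its bound
      0.079.\<close>
    define h where "h j = sgm (b \<bullet> z j) * (b \<bullet> z j - t) + 0.079 / 2 * (sgm (b \<bullet> z j))\<^sup>2" for j
    have step: "potential a ?B t (sgd_step z \<alpha> b j) \<le> ?D + ?B + 2 * \<alpha> * h j" for j
    proof -
      have "\<alpha> * R\<^sup>2 / 2 * (sgm (b \<bullet> z j))\<^sup>2 \<le> 0.079 / 2 * (sgm (b \<bullet> z j))\<^sup>2"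
        using small by (intro mult_right_mono) auto
      then have "2 * \<alpha> * (sgm (b \<bullet> z j) * (b \<bullet> z j - t) + \<alpha> * R\<^sup>2 / 2 * (sgm (b \<bullet> z j))\<^sup>2) \<le> 2 * \<alpha> * h j"
        unfolding h_def using \<alpha> by (intro mult_left_mono add_left_mono) auto
      moreover have c: "t / \<rho> * \<rho> = t" "0 \<le> t / \<rho>" "0 \<le> \<alpha>"
        using t \<rho>_pos \<alpha> by simp_all
      ultimately have "(norm (sgd_step z \<alpha> b j - (t / \<rho>) *\<^sub>R u))\<^sup>2 \<le> ?D + 2 * \<alpha> * h j"
        using norm_sgd_step_diff[OF c(3) c(2), of b j, unfolded c(1)] by linarith
      then show ?thesis
        unfolding potential_def by (intro min.coboundedI2) simp
    qed
    have "2 * \<alpha> * avg h \<le> - (if ?bad then \<alpha> * \<kappa> else 0)"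
    proof (cases ?bad)
      case bad: True
      then obtain i where i: "b \<bullet> z i < 0" by blast
      have hi: "h i \<le> - (t - 0.079 / 4) / 2"
      proof -
        define s where "s = sgm (b \<bullet> z i)"
        have s: "1 / 2 \<le> s" "s \<le> 1"
          using i sgm_nonpos[of "b \<bullet> z i"] sgm_less_1[of "b \<bullet> z i"] by (auto simp: s_def)
        have "s * (b \<bullet> z i) \<le> 0" using s i by (simp add: mult_nonneg_nonpos)
        \<comment> \<open>For a misclassified sample the worst weight is \<open>s = 1 / 2\<close>;
          the product is the difference between the claimed bound at 1/2 and the value at
          \<open>s\<close>.\<close>
        moreover have "0 \<le> (s - 1 / 2) * (t - 0.079 * (s + 1 / 2) / 2)"
          using s t by (intro mult_nonneg_nonneg) auto
        ultimately show ?thesis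
          by (simp add: h_def s_def[symmetric] power2_eq_square field_simps)
      qed
      have hj: "h j \<le> w" for j
      proof -
        define s where "s = sgm (b \<bullet> z j)"
        have s: "0 < s" "s \<le> 1"
          using sgm_pos[of "b \<bullet> z j"] sgm_less_1[of "b \<bullet> z j"] by (auto simp: s_def)
        have h: "h j = s * (b \<bullet> z j - t + 0.079 / 2 * s)"
          by (simp add: h_def s_def power2_eq_square algebra_simps)
        show ?thesis
        proof (cases "b \<bullet> z j \<le> 0")
          case True
          then have "h j \<le> 0"
            unfolding h using s t by (intro mult_nonneg_nonpos) auto
          with w0 show ?thesis by simp
        next
          case False
          then have "s \<le> 1 / 2" unfolding s_def by (intro sgm_nonneg) simp
          \<comment> \<open>With \<open>s \<le> 1 / 2\<close> the quadratic term merely lowers the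
            threshold from \<open>t\<close> to \<open>t - 0.079 / 4\<close>.\<close>
          then have "h j \<le> s * (b \<bullet> z j - (t - 0.079 / 4))"
            unfolding h using s by (intro mult_left_mono) auto
          also have "\<dots> \<le> w" unfolding s_def by (rule sgm_mult_diff_le'[OF w])
          finally show ?thesis .
        qed
      qed
      have "sum h UNIV = h i + sum h (UNIV - {i})" by (simp add: sum.remove)
      also have "\<dots> \<le> - (t - 0.079 / 4) / 2 + of_nat (card (UNIV - {i})) * w"
        using hi hj by (intro add_mono sum_bounded_above) auto
      also have "of_nat (card (UNIV - {i})) = ?n - 1"
        by (simp add: card_Diff_singleton of_nat_diff Suc_leI)
      finally have "2 * avg h \<le> - \<kappa>"
        by (simp add: avg_def \<kappa>_def field_simps)
      from mult_left_mono[OF this, of \<alpha>] \<alpha> bad show ?thesis by (simp add: algebra_simps)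
    next
      case nbad: False
      \<comment> \<open>Without a misclassification the branch condition still gives a loss above
        \<open>l\<close>, and convexity then makes the average of \<open>h\<close>
        nonpositive.\<close>
      have "0 \<le> ?D" by simp
      with False have "a * l ^ 12 < a * loss z b ^ 12" by linarith
      then have "l ^ 12 < loss z b ^ 12" using a by simp
      then have "l < loss z b" by (rule power_less_imp_less_base) (simp add: less_imp_le loss_pos)
      then have "logistic t \<le> (1 - 0.079 / 4) * loss z b" by (simp add: l_def field_simps)
      moreover have "avg h \<le> avg (\<lambda>j. logistic t + - (1 - 0.079 / 4) * logistic (b \<bullet> z j))"
      proof (rule avg_mono)
        fix j
        show "h j \<le> logistic t + - (1 - 0.079 / 4) * logistic (b \<bullet> z j)"
          using sgm_mult_diff_le[of "b \<bullet> z j" t] sgm_square_le[of "b \<bullet> z j"]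
          by (simp add: h_def algebra_simps)
      qed
      ultimately have "avg h \<le> 0"
        unfolding avg_add avg_const avg_cmult loss_def by simp
      with \<alpha> nbad show ?thesis by (simp add: mult_nonneg_nonpos)
    qed
    moreover have "avg (\<lambda>j. potential a ?B t (sgd_step z \<alpha> b j)) \<le> avg (\<lambda>j. ?D + ?B + 2 * \<alpha> * h j)"
      by (rule avg_mono) (rule step)
    moreover have "potential a ?B t b = ?D + ?B" using False by (simp add: potential_def)
    ultimately show ?thesis unfolding avg_add avg_const avg_cmult by simp
  qed
qed

end

section \<open>Numerical choice of the potential's parameters\<close>

lemma ln2_bounds: "0.6931 \<le> ln (2 :: real)" "ln (2 :: real) \<le> 0.6932"
  using ln_approx_bounds[of 2 4] by (simp_all add: eval_nat_numeral)

lemma ln3_bounds: "1.0986 \<le> ln (3 :: real)" "ln (3 :: real) \<le> 1.0987"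
  using ln_approx_bounds[of 3 7] by (simp_all add: eval_nat_numeral)

text \<open>The case of two samples. Taking \<open>t = ln 3\<close> gives
  \<open>exp (- t) = 1 / 3\<close> and \<open>logistic t = ln (4 / 3)\<close>, both computable from
  the bounds on ln 2 and ln 3. The last inequality says, after division by \<rho> squared, that
  \<open>t\<^sup>2 / \<rho>\<^sup>2\<close> plus the offset, which bounds the initial potential,
  fits into the budget of \<open>misclassification_potential\<close>.\<close>

lemma potential_parameters_2:
  fixes t w \<kappa> l :: real
  defines "t \<equiv> ln 3" and "w \<equiv> 0.112"
    and "\<kappa> \<equiv> (t - 0.079 / 4) / 2 - w"
    and "l \<equiv> logistic t / (1 - 0.079 / 4)"
  shows "exp (- (1 + (t - 0.079 / 4) + w)) \<le> w"
    and "0 < \<kappa>"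
    and "t\<^sup>2 \<le> \<kappa> * (1.1 * ln 2 * 4 - 16 / (12 * 0.45) * l * (l / (ln 2 / 2)) ^ 11)"
proof -
  have "exp (- (1 + (t - 0.079 / 4) + w)) = exp (- t) * exp (- (1.09225 :: real))"
    unfolding exp_add[symmetric] w_def by simp
  also have "exp (- t) = 1 / 3"
    by (simp add: t_def exp_minus)
  also have "exp (- (1.09225 :: real)) \<le> 0.336"
  proof -
    \<comment> \<open>Splitting off ln 3 leaves an exponent so small that the tangent of
      \<open>exp\<close> suffices.\<close>
    have "exp (ln 3 + (- 0.00645)) \<le> exp (1.09225 :: real)"
      using ln3_bounds by simp
    moreover have "1 + (- 0.00645) \<le> exp (- 0.00645 :: real)"
      by (rule exp_ge_add_one_self)
    ultimately have "2.98 \<le> exp (1.09225 :: real)"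
      unfolding exp_add by simp
    then show ?thesis
      unfolding exp_minus by (simp add: field_simps)
  qed
  finally show "exp (- (1 + (t - 0.079 / 4) + w)) \<le> w"
    by (simp add: w_def)
  have \<kappa>: "0.4274 \<le> \<kappa>"
    using ln3_bounds by (simp add: \<kappa>_def t_def w_def)
  then show "0 < \<kappa>" by simp
  have "logistic t = ln (4 / 3)"
    by (simp add: logistic_def t_def exp_minus)
  also have "\<dots> = 2 * ln 2 - ln 3"
    using ln_realpow[of 2 2] by (simp add: ln_div)
  finally have "logistic t \<le> 0.2878"
    using ln2_bounds ln3_bounds by simp
  then have l: "0 \<le> l" "l \<le> 0.2937"
    using logistic_pos[of t] by (simp_all add: l_def field_simps)
  \<comment> \<open>The ratio of \<open>l\<close> to the least loss with a misclassification is
    below 1, so its eleventh power makes the offset cheap.\<close>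
  have "l / (ln 2 / 2) \<le> 0.2937 / (0.6931 / 2)"
    using l ln2_bounds by (intro frac_le) auto
  also have "\<dots> \<le> (0.8476 :: real)" by simp
  finally have "(l / (ln 2 / 2)) ^ 11 \<le> 0.8476 ^ 11"
    using l by (intro power_mono) auto
  also have "\<dots> \<le> (0.1624 :: real)" by (simp add: eval_nat_numeral)
  finally have "16 / (12 * 0.45) * l * (l / (ln 2 / 2)) ^ 11 \<le> 16 / (12 * 0.45) * 0.2937 * 0.1624"
    using l by (intro mult_mono) auto
  then have "2.9 \<le> 1.1 * ln 2 * 4 - 16 / (12 * 0.45) * l * (l / (ln 2 / 2)) ^ 11"
    using ln2_bounds by simp
  with \<kappa> have "0.4274 * 2.9 \<le> \<kappa> * (1.1 * ln 2 * 4 - 16 / (12 * 0.45) * l * (l / (ln 2 / 2)) ^ 11)"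
    by (intro mult_mono) auto
  moreover have "t\<^sup>2 \<le> 1.0987\<^sup>2"
    using ln3_bounds unfolding t_def by (intro power_mono) auto
  ultimately show "t\<^sup>2 \<le> \<kappa> * (1.1 * ln 2 * 4 - 16 / (12 * 0.45) * l * (l / (ln 2 / 2)) ^ 11)"
    by (simp add: power2_eq_square)
qed

text \<open>With \<open>t = ln N + 0.7\<close>, both \<open>w\<close> and \<open>l\<close> are of
  order \<open>1 / N\<close>, so the total gain of the other samples and the ratio of
  \<open>l\<close> to \<open>ln 2 / N\<close> stay bounded in \<open>N\<close>.\<close>

lemma potential_parameters_ge_3:
  fixes N t w \<kappa> l :: real
  defines "t \<equiv> ln N + 0.7" and "w \<equiv> exp (- (1 + (t - 0.079 / 4)))"
    and "\<kappa> \<equiv> 2 / N * ((t - 0.079 / 4) / 2 - (N - 1) * w)"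
    and "l \<equiv> logistic t / (1 - 0.079 / 4)"
  assumes N: "N = 3 \<or> 4 \<le> N"
  shows "exp (- (1 + (t - 0.079 / 4) + w)) \<le> w"
    and "0 < \<kappa>"
    and "t\<^sup>2 \<le> \<kappa> * (1.1 * ln 2 * N\<^sup>2 - 4 * N\<^sup>2 / (12 * 0.45) * l * (l / (ln 2 / N)) ^ 11)"
proof -
  have N0: "3 \<le> N" using N by auto
  show "exp (- (1 + (t - 0.079 / 4) + w)) \<le> w"
    unfolding w_def by simp
  have w: "w \<le> 0.187 / N"
  proof -
    have "w = exp (- ln N) * exp (- (1.68025 :: real))"
      unfolding exp_add[symmetric] w_def t_def by simp
    also have "exp (- ln N) = 1 / N"
      using N0 by (simp add: exp_minus inverse_eq_divide)
    also have "exp (- (1.68025 :: real)) \<le> 0.187"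
    proof -
      have "ln (16 / 3 :: real) = 4 * ln 2 - ln 3"
        using ln_realpow[of 2 4] by (simp add: ln_div)
      then have "exp (ln (16 / 3) + 0.006) \<le> exp (1.68025 :: real)"
        using ln2_bounds ln3_bounds by simp
      moreover have "1 + 0.006 \<le> exp (0.006 :: real)"
        by (rule exp_ge_add_one_self)
      ultimately have "5.36 \<le> exp (1.68025 :: real)"
        unfolding exp_add by simp
      then show ?thesis
        unfolding exp_minus by (simp add: field_simps)
    qed
    finally show ?thesis using N0 by (simp add: divide_right_mono)
  qed
  have \<kappa>: "(t - 0.02 - 0.374 * ((N - 1) / N)) / N \<le> \<kappa>"
  proof -
    define p where "p = (N - 1) * w"
    define q where "q = (N - 1) / N"
    have "p \<le> (N - 1) * (0.187 / N)"
      unfolding p_def using w N0 by (intro mult_left_mono) auto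
    also have "\<dots> = 0.187 * q" by (simp add: q_def)
    finally have "t - 0.02 - 0.374 * q \<le> 2 * ((t - 0.079 / 4) / 2 - p)"
      by (simp add: field_simps)
    then have "t - 0.02 - 0.374 * ((N - 1) / N) \<le> 2 * ((t - 0.079 / 4) / 2 - (N - 1) * w)"
      unfolding p_def q_def .
    then show ?thesis
      unfolding \<kappa>_def using N0 by (simp add: divide_right_mono)
  qed
  have "logistic t \<le> exp (- ln N) * exp (- 0.7)"
    using logistic_le_exp[of t] by (simp add: t_def exp_add[symmetric])
  also have "\<dots> \<le> 1 / N * (1 / 2)"
  proof (rule mult_mono)
    have "exp (- 0.7) \<le> exp (- ln 2 :: real)"
      using ln2_bounds by simp
    then show "exp (- 0.7 :: real) \<le> 1 / 2" by (simp add: exp_minus)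
  qed (use N0 in \<open>auto simp: exp_minus inverse_eq_divide\<close>)
  finally have l: "0 \<le> l" "l \<le> 0.511 / N"
    using logistic_pos[of t] N0 by (simp_all add: l_def field_simps)
  have "l / (ln 2 / N) \<le> (0.511 / N) / (0.6931 / N)"
    using l ln2_bounds N0 by (intro frac_le) (auto intro: divide_right_mono)
  also have "\<dots> \<le> (0.738 :: real)" using N0 by simp
  finally have "(l / (ln 2 / N)) ^ 11 \<le> 0.738 ^ 11"
    using l N0 by (intro power_mono) auto
  also have "\<dots> \<le> (0.036 :: real)" by (simp add: eval_nat_numeral)
  finally have "4 * N\<^sup>2 / (12 * 0.45) * l * (l / (ln 2 / N)) ^ 11
      \<le> 4 * N\<^sup>2 / (12 * 0.45) * (0.511 / N) * 0.036"
    using l N0 by (intro mult_mono) auto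
  also have "\<dots> \<le> 0.0137 * N"
    using N0 by (simp add: power2_eq_square)
  also have "\<dots> \<le> 0.0137 * (N\<^sup>2 / 3)"
    using N0 by (simp add: power2_eq_square)
  also have "\<dots> \<le> 0.0046 * N\<^sup>2" by simp
  finally have small: "4 * N\<^sup>2 / (12 * 0.45) * l * (l / (ln 2 / N)) ^ 11 \<le> 0.0046 * N\<^sup>2" .
  \<comment> \<open>The offset takes at most \<open>0.0046 * N\<^sup>2\<close> of a budget of at
    least \<open>0.7624 * N\<^sup>2\<close>, which leaves \<open>0.757 * N\<^sup>2\<close>.\<close>
  have "0.7624 * N\<^sup>2 \<le> 1.1 * ln 2 * N\<^sup>2"
    using ln2_bounds by (intro mult_right_mono) auto
  moreover have "0.757 * N\<^sup>2 + 0.0046 * N\<^sup>2 \<le> 0.7624 * N\<^sup>2" by simp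
  ultimately have budget: "0.757 * N\<^sup>2 \<le> 1.1 * ln 2 * N\<^sup>2 - 4 * N\<^sup>2 / (12 * 0.45) * l * (l / (ln 2 / N)) ^ 11"
    using small by linarith
  have main: "0 < t - 0.02 - 0.374 * ((N - 1) / N) \<and>
      t\<^sup>2 \<le> (t - 0.02 - 0.374 * ((N - 1) / N)) / N * (0.757 * N\<^sup>2)"
    using N
  proof
    assume N3: "N = 3"
    have t: "1.7986 \<le> t" "t \<le> 1.7987" using ln3_bounds by (auto simp: t_def N3)
    then have "t\<^sup>2 \<le> 1.7987\<^sup>2" by (intro power_mono) auto
    also have "\<dots> \<le> 1.529 * 2.271" by (simp add: power2_eq_square)
    finally show ?thesis using t by (simp add: N3 power2_eq_square)
  next
    assume N4: "4 \<le> N"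
    have "ln 4 = 2 * ln (2 :: real)" using ln_realpow[of 2 2] by simp
    moreover have "ln 4 \<le> ln N" using N4 by simp
    ultimately have t: "2.086 \<le> t" using ln2_bounds by (simp add: t_def)
    \<comment> \<open>The tangent of \<open>ln\<close> at 4 bounds \<open>N\<close> below by a
      linear function of \<open>t\<close>. What remains is a quadratic inequality in
      \<open>t\<close>, which follows from the nonnegative product below; 0.394 is 0.02 +
      0.374.\<close>
    have "ln (N / 4) \<le> N / 4 - 1" using N4 by (intro ln_le_minus_one) auto
    then have "4 * (t - 1.0865) \<le> N"
      using \<open>ln 4 = _\<close> ln2_bounds N4 by (simp add: t_def ln_div)
    then have "4 * (t - 1.0865) * (t - 0.394) \<le> N * (t - 0.394)"
      using t by (intro mult_right_mono) auto
    moreover have "4 * (t - 1.0865) * (t - 0.394) = 4 * t\<^sup>2 - 5.922 * t + 1.712324"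
      by (simp add: power2_eq_square field_simps)
    moreover have "0 \<le> (t - 2.086) * (2.028 * t - 0.253)"
      using t by (intro mult_nonneg_nonneg) auto
    moreover have "(t - 2.086) * (2.028 * t - 0.253) = 2.028 * t\<^sup>2 - 4.483408 * t + 0.527758"
      by (simp add: power2_eq_square field_simps)
    ultimately have "t\<^sup>2 \<le> 0.757 * (N * (t - 0.394))"
      using t by simp
    also have "\<dots> \<le> 0.757 * (N * (t - 0.02 - 0.374 * ((N - 1) / N)))"
      using N4 by (intro mult_left_mono) (auto simp: field_simps)
    also have "\<dots> = (t - 0.02 - 0.374 * ((N - 1) / N)) / N * (0.757 * N\<^sup>2)"
      using N4 by (simp add: power2_eq_square)
    finally have "t\<^sup>2 \<le> (t - 0.02 - 0.374 * ((N - 1) / N)) / N * (0.757 * N\<^sup>2)" .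
    moreover have "(N - 1) / N \<le> 1" using N4 by simp
    moreover have "0 < t - 0.02 - 0.374 * q" if "q \<le> 1" for q
      using t that by (simp add: field_simps)
    ultimately show ?thesis by blast
  qed
  then have "0 < (t - 0.02 - 0.374 * ((N - 1) / N)) / N" using N0 by simp
  with \<kappa> show "0 < \<kappa>" by linarith
  note main[THEN conjunct2]
  also have "(t - 0.02 - 0.374 * ((N - 1) / N)) / N * (0.757 * N\<^sup>2)
      \<le> \<kappa> * (1.1 * ln 2 * N\<^sup>2 - 4 * N\<^sup>2 / (12 * 0.45) * l * (l / (ln 2 / N)) ^ 11)"
    using \<kappa> budget \<open>0 < \<kappa>\<close> by (intro mult_mono) auto
  finally show "t\<^sup>2 \<le> \<kappa> * (1.1 * ln 2 * N\<^sup>2 - 4 * N\<^sup>2 / (12 * 0.45) * l * (l / (ln 2 / N)) ^ 11)" .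
qed

context margin_data
begin

text \<open>Hides the parameters: only the ratio of \<open>V 0\<close> to \<kappa> enters the bound
  on the misclassification probability.\<close>

lemma misclassification_potential:
  assumes n: "2 \<le> CARD('n)" and \<alpha>: "0 < \<alpha>" and small: "\<alpha> * R\<^sup>2 \<le> 0.079"
    and noise: "\<alpha> * R ^ 4 * real CARD('n) \<le> 8 * 0.0394 * \<rho>\<^sup>2"
    and noise': "\<alpha> * R ^ 3 * real CARD('n) \<le> 0.24 * \<rho>"
  obtains V :: "'a \<Rightarrow> real" and \<kappa> :: real
  where "0 < \<kappa>" and "\<And>b. 0 \<le> V b"
    and "\<And>b. avg (\<lambda>j. V (sgd_step z \<alpha> b j)) \<le> V b - (if \<exists>i. b \<bullet> z i < 0 then \<alpha> * \<kappa> else 0)"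
    and "V 0 \<le> \<kappa> * (1.1 * ln 2 * (real CARD('n))\<^sup>2 / \<rho>\<^sup>2)"
proof -
  let ?n = "real CARD('n)"
  define ka where "ka t w = 2 / ?n * ((t - 0.079 / 4) / 2 - (?n - 1) * w)" for t w :: real
  define l where "l t = logistic t / (1 - 0.079 / 4)" for t
  obtain t w where tw: "0.079 \<le> t" "exp (- (1 + (t - 0.079 / 4) + w)) \<le> w" "0 < ka t w"
    "t\<^sup>2 \<le> ka t w * (1.1 * ln 2 * ?n\<^sup>2 - 4 * ?n\<^sup>2 / (12 * 0.45) * l t * (l t / (ln 2 / ?n)) ^ 11)"
  proof (cases "CARD('n) = 2")
    case True
    show ?thesis
    proof (rule that[of "ln 3" "0.112"])
      show "0.079 \<le> ln (3 :: real)" using ln3_bounds by simp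
    qed (use potential_parameters_2 True in \<open>simp_all add: ka_def l_def\<close>)
  next
    case False
    with n have "CARD('n) = 3 \<or> 4 \<le> CARD('n)" by linarith
    then have N: "?n = 3 \<or> 4 \<le> ?n" by auto
    then have "0 \<le> ln ?n" by auto
    then have "0.079 \<le> ln ?n + 0.7" by simp
    then show ?thesis
      by (rule that[unfolded ka_def l_def, OF _ potential_parameters_ge_3[OF N]])
  qed
  define a where "a = 4 * ?n\<^sup>2 * ka t w / (12 * 0.45 * \<rho>\<^sup>2 * (ln 2 / ?n) ^ 11)"
  have a: "0 < a"
    unfolding a_def using tw \<rho>_pos by (intro divide_pos_pos mult_pos_pos) auto
  have l: "0 < l t" unfolding l_def by (simp add: logistic_pos)
  show thesis
  proof (rule that[of "ka t w" "potential a (a * l t ^ 12) t"])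
    show "0 < ka t w" by fact
    show "0 \<le> potential a (a * l t ^ 12) t b" for b
      unfolding potential_def using a l loss_pos[of z b] by simp
    show "avg (\<lambda>j. potential a (a * l t ^ 12) t (sgd_step z \<alpha> b j))
        \<le> potential a (a * l t ^ 12) t b - (if \<exists>i. b \<bullet> z i < 0 then \<alpha> * ka t w else 0)" for b
      using avg_potential_sgd_step[OF \<alpha> small noise noise' tw(1,2) tw(3)[unfolded ka_def], of b]
      unfolding a_def ka_def l_def .
    have "(norm ((t / \<rho>) *\<^sub>R u))\<^sup>2 = (t / \<rho>)\<^sup>2 * (norm u)\<^sup>2"
      by (simp add: power_mult_distrib power_divide)
    also have "\<dots> \<le> (t / \<rho>)\<^sup>2 * 1"
      using norm_u by (intro mult_left_mono power_le_one) auto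
    finally have pot_0: "potential a (a * l t ^ 12) t 0 \<le> t\<^sup>2 / \<rho>\<^sup>2 + a * l t ^ 12"
      by (simp add: potential_def min.coboundedI2 power_divide)
    \<comment> \<open>Eleven of the twelve factors \<open>l t\<close> pair with the power of
      \<open>ln 2 / n\<close> in the denominator of \<open>a\<close>.\<close>
    have B_eq: "a * l t ^ 12
        = ka t w * (4 * ?n\<^sup>2 / (12 * 0.45) * l t * (l t / (ln 2 / ?n)) ^ 11) / \<rho>\<^sup>2"
    proof -
      have "l t ^ 12 = l t * l t ^ 11" by (simp add: eval_nat_numeral)
      then show ?thesis
        unfolding a_def power_divide[of "l t"] by (simp add: ac_simps)
    qed
    have "t\<^sup>2 / \<rho>\<^sup>2 + a * l t ^ 12 \<le> ka t w * (1.1 * ln 2 * ?n\<^sup>2) / \<rho>\<^sup>2"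
      unfolding B_eq add_divide_distrib[symmetric]
    proof (rule divide_right_mono)
      show "t\<^sup>2 + ka t w * (4 * ?n\<^sup>2 / (12 * 0.45) * l t * (l t / (ln 2 / ?n)) ^ 11)
          \<le> ka t w * (1.1 * ln 2 * ?n\<^sup>2)"
        using tw(4) unfolding right_diff_distrib by linarith
    qed simp
    with pot_0 show "potential a (a * l t ^ 12) t 0 \<le> ka t w * (1.1 * ln 2 * ?n\<^sup>2 / \<rho>\<^sup>2)"
      unfolding times_divide_eq_right by (rule order_trans)
  qed
qed

end

subsection \<open>Expectations over the run\<close>

text \<open>The first \<open>m\<close> draws form one of finitely many histories, each of
  probability \<open>n\<close> to the power \<open>- m\<close>, and \<open>Q\<close> depends on the
  history only. Hence the variable is a finite combination of indicators.\<close>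

lemma (in prob_space)
  fixes J :: "nat \<Rightarrow> 'a \<Rightarrow> 'n::finite" and Q :: "(nat \<Rightarrow> 'n) \<Rightarrow> real"
  assumes indep: "indep_vars (\<lambda>_. count_space UNIV) J {..<k}"
    and unif: "\<And>t. t < k \<Longrightarrow> distr M (count_space UNIV) (J t) = uniform_count_measure UNIV"
    and m: "m \<le> k"
    and Q: "\<And>f g. (\<And>t. t < m \<Longrightarrow> f t = g t) \<Longrightarrow> Q f = Q g"
  shows expectation_iid_uniform:
      "expectation (\<lambda>\<omega>. Q (\<lambda>t. J t \<omega>)) = (\<Sum>h\<in>PiE {..<m} (\<lambda>_. UNIV). Q h) / real CARD('n) ^ m"
    and integrable_iid_uniform: "integrable M (\<lambda>\<omega>. Q (\<lambda>t. J t \<omega>))"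
proof -
  let ?H = "PiE {..<m} (\<lambda>_. UNIV :: 'n set)"
  let ?E = "\<lambda>h. {\<omega> \<in> space M. \<forall>t<m. J t \<omega> = h t}"
  have J: "J t \<in> measurable M (count_space UNIV)" if "t < k" for t
    by (rule bspec[OF conjunct1[OF indep[unfolded indep_vars_def]]]) (use that in simp)
  \<comment> \<open>The outer intersection with \<open>space M\<close> makes the equation valid for
    \<open>m = 0\<close>, where the inner intersection is \<open>UNIV\<close>.\<close>
  have E_eq: "?E h = (\<Inter>t\<in>{..<m}. J t -` {h t} \<inter> space M) \<inter> space M" for h
    by auto
  have prob_J: "prob (J t -` {j} \<inter> space M) = 1 / real CARD('n)" if "t < k" for t j
  proof -
    have "prob (J t -` {j} \<inter> space M) = measure (distr M (count_space UNIV) (J t)) {j}"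
      by (rule measure_distr[OF J[OF that], symmetric]) simp
    then show ?thesis
      using that by (simp add: unif measure_uniform_count_measure)
  qed
  have E: "?E h \<in> events" for h
  proof -
    have "J t -` {h t} \<inter> space M \<in> events" if "t < m" for t
      using J[of t] that m by (auto intro: measurable_sets)
    then have "(\<Inter>t\<in>{..<m}. J t -` {h t} \<inter> space M) \<in> events" if "m \<noteq> 0"
      using that by (intro sets.finite_INT) auto
    then show ?thesis
      unfolding E_eq by (cases "m = 0") auto
  qed
  have prob_E: "prob (?E h) = 1 / real CARD('n) ^ m" for h
  proof (cases "m = 0")
    case True
    then show ?thesis by (simp add: prob_space)
  next
    case False
    then have "prob (?E h) = prob (\<Inter>t\<in>{..<m}. J t -` {h t} \<inter> space M)"
      unfolding E_eq by (intro arg_cong[where f = prob]) auto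
    also have "\<dots> = (\<Prod>t<m. prob (J t -` {h t} \<inter> space M))"
      using False m by (intro indep_varsD[OF indep]) auto
    also have "\<dots> = (\<Prod>t<m. 1 / real CARD('n))"
      using m by (intro prod.cong) (auto simp: prob_J)
    finally show ?thesis by (simp add: power_one_over)
  qed
  have fin: "finite ?H" by (intro finite_PiE) auto
  have eq: "Q (\<lambda>t. J t \<omega>) = (\<Sum>h\<in>?H. Q h * indicator (?E h) \<omega>)" if "\<omega> \<in> space M" for \<omega>
  proof -
    let ?h = "restrict (\<lambda>t. J t \<omega>) {..<m}"
    have "(\<Sum>h\<in>?H. Q h * indicator (?E h) \<omega>) = (\<Sum>h\<in>{?h}. Q h * indicator (?E h) \<omega>)"
    proof (rule sum.mono_neutral_right)
      show "\<forall>h\<in>?H - {?h}. Q h * indicator (?E h) \<omega> = 0"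
      proof
        fix h assume "h \<in> ?H - {?h}"
        then have ne: "h \<noteq> ?h" and ext: "h \<in> extensional {..<m}"
          by (simp_all add: PiE_def)
        have "\<not> (\<forall>t<m. J t \<omega> = h t)"
        proof
          assume "\<forall>t<m. J t \<omega> = h t"
          then have "h = ?h" by (intro extensionalityI[OF ext restrict_extensional]) simp
          with ne show False ..
        qed
        then show "Q h * indicator (?E h) \<omega> = 0" by simp
      qed
    qed (use fin in auto)
    also have "\<dots> = Q ?h" using that by simp
    also have "\<dots> = Q (\<lambda>t. J t \<omega>)" by (rule Q) simp
    finally show ?thesis by simp
  qed
  have int: "integrable M (\<lambda>\<omega>. Q h * indicator (?E h) \<omega>)" for h
    by (intro integrable_mult_right integrable_real_indicator E) (simp add: emeasure_eq_measure)
  have exp_E: "expectation (\<lambda>\<omega>. Q h * indicator (?E h) \<omega>) = Q h * prob (?E h)" for h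
    by (simp only: integral_mult_right_zero Bochner_Integration.integral_indicator sets.Int_space_eq2[OF E])
  show "integrable M (\<lambda>\<omega>. Q (\<lambda>t. J t \<omega>))"
    by (rule iffD2[OF Bochner_Integration.integrable_cong[OF refl eq]])
      (assumption, intro Bochner_Integration.integrable_sum int)
  have "expectation (\<lambda>\<omega>. Q (\<lambda>t. J t \<omega>)) = expectation (\<lambda>\<omega>. \<Sum>h\<in>?H. Q h * indicator (?E h) \<omega>)"
    by (intro Bochner_Integration.integral_cong eq refl)
  also have "\<dots> = (\<Sum>h\<in>?H. Q h * prob (?E h))"
    by (simp only: Bochner_Integration.integral_sum[OF int] exp_E)
  finally show "expectation (\<lambda>\<omega>. Q (\<lambda>t. J t \<omega>)) = (\<Sum>h\<in>?H. Q h) / real CARD('n) ^ m"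
    by (simp add: prob_E sum_divide_distrib)
qed

text \<open>The tower property for a fresh draw. Histories of length \<open>m + 1\<close> correspond
  to pairs of a last index and a history of length \<open>m\<close>, so the finite sum can be
  evaluated over the last index first.\<close>

lemma (in prob_space) expectation_iid_uniform_Suc:
  fixes J :: "nat \<Rightarrow> 'a \<Rightarrow> 'n::finite" and g :: "(nat \<Rightarrow> 'n) \<Rightarrow> 'v" and F :: "'v \<Rightarrow> 'n \<Rightarrow> real"
  assumes indep: "indep_vars (\<lambda>_. count_space UNIV) J {..<k}"
    and unif: "\<And>t. t < k \<Longrightarrow> distr M (count_space UNIV) (J t) = uniform_count_measure UNIV"
    and m: "m < k"
    and g: "\<And>f f'. (\<And>t. t < m \<Longrightarrow> f t = f' t) \<Longrightarrow> g f = g f'"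
  shows "expectation (\<lambda>\<omega>. F (g (\<lambda>t. J t \<omega>)) (J m \<omega>))
    = expectation (\<lambda>\<omega>. avg (F (g (\<lambda>t. J t \<omega>))))"
proof -
  let ?H = "\<lambda>m. PiE {..<m} (\<lambda>_. UNIV :: 'n set)"
  have "expectation (\<lambda>\<omega>. F (g (\<lambda>t. J t \<omega>)) (J m \<omega>))
      = (\<Sum>h\<in>?H (Suc m). F (g h) (h m)) / real CARD('n) ^ Suc m"
  proof (rule expectation_iid_uniform[where Q = "\<lambda>h. F (g h) (h m)", OF indep unif])
    fix f f' :: "nat \<Rightarrow> 'n" assume eq: "\<And>t. t < Suc m \<Longrightarrow> f t = f' t"
    then have "g f = g f'" by (intro g) simp
    with eq[of m] show "F (g f) (f m) = F (g f') (f' m)" by simp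
  qed (use m in auto)
  also have "(\<Sum>h\<in>?H (Suc m). F (g h) (h m)) = (\<Sum>(j, h)\<in>UNIV \<times> ?H m. F (g h) j)"
  proof -
    have H: "?H (Suc m) = (\<lambda>(j, h). h(m := j)) ` (UNIV \<times> ?H m)"
      by (simp add: lessThan_Suc PiE_insert_eq)
    have inj: "inj_on (\<lambda>(j, h). h(m := j)) (UNIV \<times> ?H m)"
      using inj_combinator[of m "{..<m}" "\<lambda>_. UNIV :: 'n set"] by simp
    have "g (h(m := j)) = g h" for h j by (rule g) simp
    then show ?thesis
      unfolding H by (subst sum.reindex[OF inj]) (auto intro!: sum.cong)
  qed
  also have "\<dots> = (\<Sum>h\<in>?H m. \<Sum>j\<in>UNIV. F (g h) j)"
    by (simp add: sum.cartesian_product[symmetric] sum.swap[of _ "?H m"])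
  also have "\<dots> / real CARD('n) ^ Suc m = (\<Sum>h\<in>?H m. avg (F (g h))) / real CARD('n) ^ m"
    by (simp add: avg_def sum_divide_distrib[symmetric])
  also have "\<dots> = expectation (\<lambda>\<omega>. avg (F (g (\<lambda>t. J t \<omega>))))"
  proof (rule expectation_iid_uniform[where Q = "\<lambda>h. avg (F (g h))", OF indep unif, symmetric])
    fix f f' :: "nat \<Rightarrow> 'n" assume "\<And>t. t < m \<Longrightarrow> f t = f' t"
    then have "g f = g f'" by (rule g)
    then show "avg (F (g f)) = avg (F (g f'))" by simp
  qed (use m in auto)
  finally show ?thesis .
qed

lemma sgd_cong: "(\<And>t. t < i \<Longrightarrow> f t = g t) \<Longrightarrow> sgd X y \<alpha> f i = sgd X y \<alpha> g i"
  by (induction i) auto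

lemma option_B_D:
  assumes "option_B M X y \<alpha> k J I"
  shows "prob_space M"
    and "prob_space.indep_vars M (\<lambda>_. count_space UNIV) J {..<k}"
    and "\<And>i. i < k \<Longrightarrow> distr M (count_space UNIV) (J i) = uniform_count_measure UNIV"
    and "\<And>\<omega>. \<omega> \<in> space M \<Longrightarrow> I \<omega> \<le> k"
    and "I \<in> measurable M (count_space {0..k})"
    and "distr M (count_space {0..k}) I = uniform_count_measure {0..k}"
    and "prob_space.indep_set M
       (sets (vimage_algebra (space M) I (count_space {0..k})))
       (sets (vimage_algebra (space M)
          (\<lambda>\<omega>. \<lambda>i\<in>{0..k}. sgd X y \<alpha> (\<lambda>t. J t \<omega>) i) (PiM {0..k} (\<lambda>_. borel))))"
  using assms measurable_space[of I M "count_space {0..k}"]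
  unfolding option_B_def by auto

text \<open>Each iterate has finite range, so the output splits into indicators of the events that
  index \<open>i\<close> is drawn and iterate \<open>i\<close> has value \<open>v\<close>.
  Independence of the index from the trajectory contributes the factor \<open>1 / (k + 1)\<close>;
  the finite range makes arbitrary \<open>F\<close> and \<open>P\<close> measurable along the
  run.\<close>

lemma
  fixes X :: "real ^ 'p ^ 'n" and F :: "real ^ 'p \<Rightarrow> real" and P :: "real ^ 'p \<Rightarrow> bool"
  assumes run: "option_B M X y \<alpha> k J I"
  shows expectation_output_B: "(\<integral>\<omega>. F (output_B X y \<alpha> J I \<omega>) \<partial>M)
      = (\<Sum>i\<le>k. \<integral>\<omega>. F (sgd X y \<alpha> (\<lambda>t. J t \<omega>) i) \<partial>M) / (real k + 1)"
    and integrable_output_B: "integrable M (\<lambda>\<omega>. F (output_B X y \<alpha> J I \<omega>))"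
    and sets_output_B: "{\<omega> \<in> space M. P (output_B X y \<alpha> J I \<omega>)} \<in> sets M"
proof -
  interpret prob_space M using run by (rule option_B_D)
  note indep = option_B_D(2)[OF run] and unif = option_B_D(3)[OF run]
    and I_le = option_B_D(4)[OF run] and I_meas = option_B_D(5)[OF run]
    and I_unif = option_B_D(6)[OF run] and indep_I = option_B_D(7)[OF run]
  define b where "b i \<omega> = sgd X y \<alpha> (\<lambda>t. J t \<omega>) i" for i \<omega>
  define V where "V i = b i ` space M" for i
  define A where "A i = I -` {i} \<inter> space M" for i
  define B where "B i v = b i -` {v} \<inter> space M" for i v
  have fin: "finite (V i)" for i
  proof (rule finite_subset)
    show "V i \<subseteq> (\<lambda>h. sgd X y \<alpha> h i) ` PiE {..<i} (\<lambda>_. UNIV)"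
    proof
      fix v assume "v \<in> V i"
      then obtain \<omega> where "v = sgd X y \<alpha> (\<lambda>t. J t \<omega>) i" by (auto simp: V_def b_def)
      also have "\<dots> = sgd X y \<alpha> (restrict (\<lambda>t. J t \<omega>) {..<i}) i" by (rule sgd_cong) simp
      finally have v: "v = sgd X y \<alpha> (restrict (\<lambda>t. J t \<omega>) {..<i}) i" .
      show "v \<in> (\<lambda>h. sgd X y \<alpha> h i) ` PiE {..<i} (\<lambda>_. UNIV)"
        by (rule image_eqI[where f = "\<lambda>h. sgd X y \<alpha> h i", OF v]) (simp add: restrict_PiE_iff)
    qed
  qed (intro finite_imageI finite_PiE, auto)
  have A_in: "A i \<in> sets (vimage_algebra (space M) I (count_space {0..k}))" if "i \<le> k" for i
    unfolding A_def using that I_le by (intro in_vimage_algebra) auto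
  \<comment> \<open>The event is the preimage, under the whole trajectory, of a cylinder set fixing
    coordinate \<open>i\<close>.\<close>
  have B_in: "B i v \<in> sets (vimage_algebra (space M)
      (\<lambda>\<omega>. \<lambda>i\<in>{0..k}. sgd X y \<alpha> (\<lambda>t. J t \<omega>) i) (PiM {0..k} (\<lambda>_. borel)))" if "i \<le> k" for i v
  proof -
    let ?f = "\<lambda>\<omega>. \<lambda>i\<in>{0..k}. sgd X y \<alpha> (\<lambda>t. J t \<omega>) i"
    let ?N = "PiM {0..k} (\<lambda>_. borel :: (real ^ 'p) measure)"
    have "(\<lambda>f. f i) -` {v} \<inter> space ?N \<in> sets ?N"
      using that by (intro measurable_sets[OF measurable_component_singleton]) auto
    then have "?f -` ((\<lambda>f. f i) -` {v} \<inter> space ?N) \<inter> space M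
        \<in> sets (vimage_algebra (space M) ?f ?N)"
      by (rule in_vimage_algebra)
    moreover have "?f -` ((\<lambda>f. f i) -` {v} \<inter> space ?N) \<inter> space M = B i v"
      using that by (auto simp: B_def b_def space_PiM)
    ultimately show ?thesis by simp
  qed
  have ev: "A i \<in> events" "B i v \<in> events" if "i \<le> k" for i v
    by (rule subsetD[OF indep_setD_ev1[OF indep_I] A_in[OF that]],
        rule subsetD[OF indep_setD_ev2[OF indep_I] B_in[OF that]])
  have prob_A: "prob (A i) = 1 / (real k + 1)" if "i \<le> k" for i
  proof -
    have "prob (A i) = measure (distr M (count_space {0..k}) I) {i}"
      unfolding A_def using that by (subst measure_distr[OF I_meas]) auto
    then show ?thesis
      using that by (simp add: I_unif measure_uniform_count_measure)
  qed
  have prob_AB: "prob (A i \<inter> B i v) = prob (B i v) / (real k + 1)" if "i \<le> k" for i v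
    using indep_setD[OF indep_I A_in[OF that] B_in[OF that]] prob_A[OF that] by simp
  have b_eq: "F (b i \<omega>) = (\<Sum>v\<in>V i. F v * indicator (B i v) \<omega>)" if "\<omega> \<in> space M" for F :: "real ^ 'p \<Rightarrow> real" and i \<omega>
  proof -
    have "(\<Sum>v\<in>V i. F v * indicator (B i v) \<omega>) = (\<Sum>v\<in>{b i \<omega>}. F v * indicator (B i v) \<omega>)"
      by (rule sum.mono_neutral_right) (use fin that in \<open>auto simp: V_def B_def\<close>)
    with that show ?thesis by (simp add: B_def)
  qed
  have out_eq: "F (output_B X y \<alpha> J I \<omega>) = (\<Sum>i\<le>k. \<Sum>v\<in>V i. F v * indicator (A i \<inter> B i v) \<omega>)"
    if "\<omega> \<in> space M" for F :: "real ^ 'p \<Rightarrow> real" and \<omega>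
  proof -
    have "(\<Sum>i\<le>k. \<Sum>v\<in>V i. F v * indicator (A i \<inter> B i v) \<omega>)
        = (\<Sum>i\<le>k. indicator (A i) \<omega> * F (b i \<omega>))"
      by (simp add: b_eq[OF that] sum_distrib_left indicator_inter_arith ac_simps)
    also have "\<dots> = (\<Sum>i\<in>{I \<omega>}. indicator (A i) \<omega> * F (b i \<omega>))"
      by (rule sum.mono_neutral_right) (use I_le that in \<open>auto simp: A_def\<close>)
    finally show ?thesis
      using that by (simp add: A_def b_def output_B_def)
  qed
  have int: "integrable M (\<lambda>\<omega>. F v * indicator (A i \<inter> B i v) \<omega>)"
      "integrable M (\<lambda>\<omega>. F v * indicator (B i v) \<omega>)" if "i \<le> k" for F :: "real ^ 'p \<Rightarrow> real" and i v
    by (intro integrable_mult_right integrable_real_indicator sets.Int ev that;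
        simp add: emeasure_eq_measure)+
  have integ: "integrable M (\<lambda>\<omega>. F (output_B X y \<alpha> J I \<omega>))" for F :: "real ^ 'p \<Rightarrow> real"
    by (rule iffD2[OF Bochner_Integration.integrable_cong[OF refl out_eq]])
      (assumption, intro Bochner_Integration.integrable_sum int, simp)
  then show "integrable M (\<lambda>\<omega>. F (output_B X y \<alpha> J I \<omega>))" .
  \<comment> \<open>Measurability of the event is read off from the integrability of its
    indicator.\<close>
  have "(\<lambda>\<omega>. if P (output_B X y \<alpha> J I \<omega>) then 1 else 0 :: real) -` {1} \<inter> space M \<in> sets M"
    by (rule measurable_sets[OF borel_measurable_integrable[OF integ[of "\<lambda>v. if P v then 1 else 0"]]]) simp
  also have "(\<lambda>\<omega>. if P (output_B X y \<alpha> J I \<omega>) then 1 else 0 :: real) -` {1} \<inter> space M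
      = {\<omega> \<in> space M. P (output_B X y \<alpha> J I \<omega>)}" by (auto split: if_splits)
  finally show "{\<omega> \<in> space M. P (output_B X y \<alpha> J I \<omega>)} \<in> sets M" .
  have "expectation (\<lambda>\<omega>. F (output_B X y \<alpha> J I \<omega>))
      = expectation (\<lambda>\<omega>. \<Sum>i\<le>k. \<Sum>v\<in>V i. F v * indicator (A i \<inter> B i v) \<omega>)"
    by (intro Bochner_Integration.integral_cong out_eq refl)
  also have "\<dots> = (\<Sum>i\<le>k. \<Sum>v\<in>V i. F v * prob (A i \<inter> B i v))"
    using int(1) ev by (subst Bochner_Integration.integral_sum
        | auto intro!: sum.cong Bochner_Integration.integrable_sum)+
  also have "\<dots> = (\<Sum>i\<le>k. \<Sum>v\<in>V i. F v * prob (B i v)) / (real k + 1)"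
    by (simp add: prob_AB sum_divide_distrib)
  also have "(\<Sum>i\<le>k. \<Sum>v\<in>V i. F v * prob (B i v)) = (\<Sum>i\<le>k. expectation (\<lambda>\<omega>. F (b i \<omega>)))"
  proof (rule sum.cong[OF refl])
    fix i assume "i \<in> {..k}"
    have "expectation (\<lambda>\<omega>. F (b i \<omega>)) = expectation (\<lambda>\<omega>. \<Sum>v\<in>V i. F v * indicator (B i v) \<omega>)"
      by (intro Bochner_Integration.integral_cong b_eq refl)
    also have "\<dots> = (\<Sum>v\<in>V i. F v * prob (B i v))"
      using int(2) ev(2) \<open>i \<in> {..k}\<close> by (subst Bochner_Integration.integral_sum) auto
    finally show "(\<Sum>v\<in>V i. F v * prob (B i v)) = expectation (\<lambda>\<omega>. F (b i \<omega>))" ..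
  qed
  finally show "expectation (\<lambda>\<omega>. F (output_B X y \<alpha> J I \<omega>))
      = (\<Sum>i\<le>k. expectation (\<lambda>\<omega>. F (sgd X y \<alpha> (\<lambda>t. J t \<omega>) i))) / (real k + 1)"
    unfolding b_def .
qed

subsection \<open>SGD on separable data\<close>

lemma GDERIV_logistic_inner: "GDERIV (\<lambda>b. logistic (b \<bullet> v)) b :> - (sgm (b \<bullet> v) *\<^sub>R v)"
proof -
  have "((\<lambda>b. b \<bullet> v) has_derivative (\<lambda>h. h \<bullet> v)) (at b)"
    by (auto intro!: derivative_eq_intros)
  then have "GDERIV (\<lambda>b. b \<bullet> v) b :> v" by (simp add: gderiv_def)
  from GDERIV_DERIV_compose[OF this DERIV_logistic] show ?thesis by simp
qed

locale sgd_run =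
  fixes X :: "real ^ 'p ^ 'n"
    and y :: "'n \<Rightarrow> real"
    and R \<alpha> :: real
    and k :: nat
    and M :: "'w measure"
    and J :: "nat \<Rightarrow> 'w \<Rightarrow> 'n"
    and I :: "'w \<Rightarrow> nat"
  assumes labels: "\<And>i. y i \<in> {-1, 1}"
    and R: "\<And>i. norm (X $ i) \<le> R"
    and sep: "separable X y"
    and k: "k \<ge> 1"
    and \<alpha>: "\<alpha> = ln 2 / (R\<^sup>2 * sqrt (real k + 1))"
    and run: "option_B M X y \<alpha> k J I"
begin

abbreviation z :: "'n \<Rightarrow> real ^ 'p" where
  "z i \<equiv> y i *\<^sub>R X $ i"

abbreviation out :: "'w \<Rightarrow> real ^ 'p" where
  "out \<equiv> output_B X y \<alpha> J I"

definition u :: "real ^ 'p" where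
  "u = (SOME u. norm u \<le> 1 \<and> deg_sep X y = margin X y u)"

lemma u: "norm u \<le> 1" "deg_sep X y = margin X y u"
  using someI_ex[of "\<lambda>u. norm u \<le> 1 \<and> deg_sep X y = margin X y u"] deg_sep_attained[of X y]
  unfolding u_def by blast+

lemma less_margin_iff: "r < margin X y b \<longleftrightarrow> (\<forall>i. r < b \<bullet> z i)"
  by (simp add: margin_def)

text \<open>A separating vector, once normalized, competes in the supremum.\<close>

lemma deg_sep_pos: "0 < deg_sep X y"
proof -
  obtain b where b: "\<And>i. 0 < b \<bullet> z i" using sep by (auto simp: separable_def)
  then have "b \<noteq> 0" by force
  then have "0 < margin X y ((1 / norm b) *\<^sub>R b)"
    unfolding less_margin_iff using b by simp
  moreover have "margin X y ((1 / norm b) *\<^sub>R b) \<le> deg_sep X y"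
    using deg_sep_attained[of X y] \<open>b \<noteq> 0\<close> by auto
  ultimately show ?thesis by simp
qed

sublocale margin_data z R "deg_sep X y" u
proof
  show "norm (z i) \<le> R" for i
    using labels[of i] R[of i] by auto
  show "deg_sep X y \<le> u \<bullet> z i" for i
    unfolding u(2) by (simp add: margin_def)
qed (use u deg_sep_pos in auto)

abbreviation \<rho> :: real where "\<rho> \<equiv> deg_sep X y"

lemma \<alpha>_pos: "0 < \<alpha>"
  using R_pos unfolding \<alpha> by (intro divide_pos_pos mult_pos_pos) auto

lemma \<alpha>_R: "\<alpha> * R\<^sup>2 = ln 2 / sqrt (real k + 1)"
  using R_pos unfolding \<alpha> by simp

lemma sgd_Suc: "sgd X y \<alpha> j (Suc i) = sgd_step z \<alpha> (sgd X y \<alpha> j i) (j i)"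
proof -
  have "sample_loss X y (j i) = (\<lambda>b. logistic (b \<bullet> z (j i)))"
    by (simp add: sample_loss_def fun_eq_iff)
  then have "grad (sample_loss X y (j i)) b = - (sgm (b \<bullet> z (j i)) *\<^sub>R z (j i))" for b
    by (simp only:) (rule grad_eqI[OF GDERIV_logistic_inner])
  then show ?thesis by (simp add: sgd_step_def)
qed

lemma grad_logistic_loss: "grad (logistic_loss X y) b = loss_grad z b"
proof (rule grad_eqI)
  have "((\<lambda>b. logistic (b \<bullet> z i)) has_derivative (\<lambda>h. h \<bullet> - (sgm (b \<bullet> z i) *\<^sub>R z i))) (at b)" for i
    using GDERIV_logistic_inner[of "z i" b] by (simp only: gderiv_def)
  then have "((\<lambda>b. (1 / real CARD('n)) * (\<Sum>i\<in>UNIV. logistic (b \<bullet> z i))) has_derivative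
      (\<lambda>h. (1 / real CARD('n)) * (\<Sum>i\<in>UNIV. h \<bullet> - (sgm (b \<bullet> z i) *\<^sub>R z i)))) (at b)"
    by (intro has_derivative_mult_right has_derivative_sum)
  moreover have "(1 / real CARD('n)) * (\<Sum>i\<in>UNIV. h \<bullet> - (sgm (b \<bullet> z i) *\<^sub>R z i)) = h \<bullet> loss_grad z b" for h
    by (simp add: loss_grad_def inner_sum_right sum_negf)
  moreover have "logistic_loss X y = (\<lambda>b. (1 / real CARD('n)) * (\<Sum>i\<in>UNIV. logistic (b \<bullet> z i)))"
    by (simp add: logistic_loss_def sample_loss_def fun_eq_iff)
  ultimately show "GDERIV (logistic_loss X y) b :> loss_grad z b"
    unfolding gderiv_def by simp
qed

section \<open>From one-step drift to the random output\<close>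

text \<open>Telescoping the drift over all iterates and dividing by \<open>k + 1\<close>. It serves
  both the gradient bound and the misclassification bound.\<close>

lemma expectation_output_le:
  fixes V h :: "real ^ 'p \<Rightarrow> real"
  assumes V: "\<And>b. 0 \<le> V b"
    and drift: "\<And>b. avg (\<lambda>j. V (sgd_step z \<alpha> b j)) \<le> V b - h b + e"
  shows "(\<integral>\<omega>. h (out \<omega>) \<partial>M) \<le> V 0 / (real k + 1) + e"
proof -
  interpret prob_space M using run by (rule option_B_D)
  note indep = option_B_D(2)[OF run] and unif = option_B_D(3)[OF run]
  let ?b = "\<lambda>i \<omega>. sgd X y \<alpha> (\<lambda>t. J t \<omega>) i"
  have int: "integrable M (\<lambda>\<omega>. F (?b i \<omega>))" if "i \<le> k" for F :: "real ^ 'p \<Rightarrow> real" and i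
    using that
    by (intro integrable_iid_uniform[where Q = "\<lambda>f. F (sgd X y \<alpha> f i)", OF indep unif]
        arg_cong[where f = F] sgd_cong)
  have next_le: "expectation (\<lambda>\<omega>. avg (\<lambda>j. V (sgd_step z \<alpha> (?b i \<omega>) j)))
      \<le> expectation (\<lambda>\<omega>. V (?b i \<omega>)) - expectation (\<lambda>\<omega>. h (?b i \<omega>)) + e" if "i \<le> k" for i
  proof -
    have "expectation (\<lambda>\<omega>. avg (\<lambda>j. V (sgd_step z \<alpha> (?b i \<omega>) j)))
        \<le> expectation (\<lambda>\<omega>. V (?b i \<omega>) - h (?b i \<omega>) + e)"
      using int[OF that] drift by (intro integral_mono) auto
    also have "\<dots> = expectation (\<lambda>\<omega>. V (?b i \<omega>)) - expectation (\<lambda>\<omega>. h (?b i \<omega>)) + e"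
      using int[OF that] by (simp add: prob_space)
    finally show ?thesis .
  qed
  have "(\<Sum>i<m. expectation (\<lambda>\<omega>. h (?b i \<omega>))) \<le> V 0 - expectation (\<lambda>\<omega>. V (?b m \<omega>)) + real m * e"
    if "m \<le> k" for m
    using that
  proof (induction m)
    case 0
    then show ?case by (simp add: prob_space)
  next
    case (Suc m)
    have "expectation (\<lambda>\<omega>. V (?b (Suc m) \<omega>))
        = expectation (\<lambda>\<omega>. V (sgd_step z \<alpha> (?b m \<omega>) (J m \<omega>)))"
      by (simp only: sgd_Suc)
    also have "\<dots> = expectation (\<lambda>\<omega>. avg (\<lambda>j. V (sgd_step z \<alpha> (?b m \<omega>) j)))"
      using Suc.prems
      by (intro expectation_iid_uniform_Suc[where g = "\<lambda>f. sgd X y \<alpha> f m"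
            and F = "\<lambda>b j. V (sgd_step z \<alpha> b j)", OF indep unif] sgd_cong) auto
    finally show ?case
      using Suc next_le[of m] by (simp add: algebra_simps)
  qed
  from this[of k] have "(\<Sum>i\<le>k. expectation (\<lambda>\<omega>. h (?b i \<omega>)))
      \<le> V 0 - expectation (\<lambda>\<omega>. V (?b k \<omega>)) + real k * e + expectation (\<lambda>\<omega>. h (?b k \<omega>))"
    by (simp add: lessThan_Suc_atMost[symmetric])
  \<comment> \<open>There are \<open>k + 1\<close> iterates but only \<open>k\<close> draws. The
    drift at iterate \<open>k\<close> therefore refers to a hypothetical further step, which enters
    only through its average and the nonnegativity of \<open>V\<close>.\<close>
  moreover have "0 \<le> expectation (\<lambda>\<omega>. avg (\<lambda>j. V (sgd_step z \<alpha> (?b k \<omega>) j)))"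
    by (intro Bochner_Integration.integral_nonneg avg_nonneg V)
  ultimately have "(\<Sum>i\<le>k. expectation (\<lambda>\<omega>. h (?b i \<omega>))) \<le> V 0 + (real k + 1) * e"
    using next_le[of k] by (simp add: algebra_simps)
  then have "(\<Sum>i\<le>k. expectation (\<lambda>\<omega>. h (?b i \<omega>))) / (real k + 1)
      \<le> (V 0 + (real k + 1) * e) / (real k + 1)"
    by (rule divide_right_mono) simp
  also have "\<dots> = V 0 / (real k + 1) + e" by (simp add: add_divide_distrib)
  finally have "(\<Sum>i\<le>k. expectation (\<lambda>\<omega>. h (?b i \<omega>))) / (real k + 1) \<le> V 0 / (real k + 1) + e" .
  then show ?thesis
    by (simp only: expectation_output_B[OF run])
qed

lemma expectation_gradient:
  "(\<integral>\<omega>. (norm (loss_grad z (out \<omega>)))\<^sup>2 \<partial>M) < 1.1 * R\<^sup>2 / sqrt (real k + 1)"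
proof -
  let ?W = "sqrt (real k + 1)"
  let ?E = "\<integral>\<omega>. (norm (loss_grad z (out \<omega>)))\<^sup>2 \<partial>M"
  have W: "0 < ?W" "real k + 1 = ?W * ?W" by auto
  have "(\<integral>\<omega>. \<alpha> * (norm (loss_grad z (out \<omega>)))\<^sup>2 \<partial>M) \<le> loss z 0 / (real k + 1) + \<alpha>\<^sup>2 * R ^ 4 / 8"
    by (rule expectation_output_le) (auto simp: less_imp_le loss_pos avg_loss_sgd_step)
  then have "\<alpha> * ?E \<le> ln 2 / (?W * ?W) + \<alpha>\<^sup>2 * R ^ 4 / 8"
    by (simp add: loss_0)
  also have "\<dots> = \<alpha> * (R\<^sup>2 / ?W + \<alpha> * R\<^sup>2 * R\<^sup>2 / 8)"
  proof -
    have "ln 2 / (?W * ?W) = \<alpha> * (R\<^sup>2 / ?W)"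
      using R_pos by (simp add: \<alpha>)
    then show ?thesis by (simp add: distrib_left power2_eq_square power4_eq_xxxx)
  qed
  finally have "?E \<le> R\<^sup>2 / ?W + \<alpha> * R\<^sup>2 * R\<^sup>2 / 8"
    using \<alpha>_pos by simp
  \<comment> \<open>The telescoped loss gives the summand 1, the noise gives
    \<open>ln 2 / 8\<close>, which is about 0.087; hence the constant 1.1.\<close>
  also have "\<dots> = (1 + ln 2 / 8) * (R\<^sup>2 / ?W)"
    unfolding \<alpha>_R by (simp add: field_simps)
  also have "\<dots> < 1.1 * (R\<^sup>2 / ?W)"
    using ln2_bounds R_pos W(1) by (intro mult_strict_right_mono divide_pos_pos) auto
  finally show ?thesis by simp
qed

section \<open>Shrinkage on every path\<close>

text \<open>The comparator \<open>c *\<^sub>R u\<close> has margin at least \<open>ln k\<close>,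
  where the loss is at most \<open>1 / k\<close>. The squared distance to it thus grows by at most
  \<open>2 * \<alpha> / k\<close> per step, in total by at most \<open>1 / R\<^sup>2\<close>. The
  norm \<open>c\<close> of the comparator is then added by the triangle inequality.\<close>

lemma norm_sgd_le:
  assumes "i \<le> k"
  shows "norm (sgd X y \<alpha> j i) \<le> 2 * ln (real k) / \<rho> + 1 / R"
proof -
  let ?W = "sqrt (real k + 1)"
  define c where "c = ln (real k) / \<rho>"
  have c: "0 \<le> c" "c * \<rho> = ln (real k)"
    using k \<rho>_pos by (auto simp: c_def)
  have "1.4 \<le> ?W" using k by (intro real_le_rsqrt) (simp add: power2_eq_square)
  then have "ln 2 / ?W \<le> 0.7 / 1.4"
    using ln2_bounds by (intro frac_le) auto
  then have \<alpha>R: "\<alpha> * R\<^sup>2 \<le> 1 / 2" unfolding \<alpha>_R by simp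
  have dist: "(norm (sgd X y \<alpha> j m - c *\<^sub>R u))\<^sup>2 \<le> c\<^sup>2 + 2 * \<alpha> * real m / real k" for m
  proof (induction m)
    case 0
    have "(norm (c *\<^sub>R u))\<^sup>2 \<le> c\<^sup>2 * 1"
      using norm_u by (simp add: power_mult_distrib mult_left_le power_le_one)
    then show ?case by simp
  next
    case (Suc m)
    let ?b = "sgd X y \<alpha> j m"
    let ?m = "?b \<bullet> z (j m)"
    \<comment> \<open>The quadratic term is absorbed by half of the loss that convexity
      subtracts.\<close>
    have "\<alpha> * R\<^sup>2 / 2 * (sgm ?m)\<^sup>2 \<le> 1 * (logistic ?m / 2)"
      using \<alpha>R by (intro mult_mono sgm_square_le) auto
    then have "sgm ?m * (?m - c * \<rho>) + \<alpha> * R\<^sup>2 / 2 * (sgm ?m)\<^sup>2 \<le> logistic (c * \<rho>)"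
      using sgm_mult_diff_le[of ?m "c * \<rho>"] logistic_pos[of ?m] by simp
    also have "\<dots> \<le> 1 / real k"
      using logistic_le_exp[of "c * \<rho>"] k by (simp add: c(2) exp_minus inverse_eq_divide)
    finally have "2 * \<alpha> * (sgm ?m * (?m - c * \<rho>) + \<alpha> * R\<^sup>2 / 2 * (sgm ?m)\<^sup>2) \<le> 2 * \<alpha> * (1 / real k)"
      using \<alpha>_pos by (intro mult_left_mono) auto
    with norm_sgd_step_diff[of \<alpha> c ?b "j m"] Suc \<alpha>_pos c(1) show ?case
      unfolding sgd_Suc by (simp add: algebra_simps add_divide_distrib)
  qed
  have "2 * \<alpha> * real i / real k \<le> 2 * \<alpha>"
    using assms k \<alpha>_pos by (simp add: field_simps)
  also have "\<dots> \<le> (1 / R)\<^sup>2"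
    using \<alpha>R R_pos by (simp add: field_simps)
  finally have "(norm (sgd X y \<alpha> j i - c *\<^sub>R u))\<^sup>2 \<le> c\<^sup>2 + (1 / R)\<^sup>2"
    using dist[of i] by linarith
  also have "\<dots> \<le> (c + 1 / R)\<^sup>2"
    using c(1) R_pos by (simp add: power2_sum)
  finally have "norm (sgd X y \<alpha> j i - c *\<^sub>R u) \<le> c + 1 / R"
    by (rule power2_le_imp_le) (use c(1) R_pos in simp)
  moreover have "norm (c *\<^sub>R u) \<le> c"
    using c(1) norm_u by (simp add: mult_left_le)
  moreover have "norm (sgd X y \<alpha> j i) \<le> norm (sgd X y \<alpha> j i - c *\<^sub>R u) + norm (c *\<^sub>R u)"
    using norm_triangle_ineq[of "sgd X y \<alpha> j i - c *\<^sub>R u" "c *\<^sub>R u"] by simp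
  ultimately show ?thesis by (simp add: c_def)
qed

lemma norm_out_le: "\<omega> \<in> space M \<Longrightarrow> norm (out \<omega>) \<le> 2 * ln (real k) / \<rho> + 1 / R"
  using norm_sgd_le option_B_D(4)[OF run] by (simp add: output_B_def)

lemma norm_2_inf_bounds: "0 < norm_2_inf X" "norm_2_inf X \<le> R"
proof -
  obtain v where v: "norm v \<le> 1" "norm_2_inf X = infnorm (X *v v)"
    "\<And>b. norm b \<le> 1 \<Longrightarrow> infnorm (X *v b) \<le> infnorm (X *v v)"
    using norm_2_inf_attained[of X] by blast
  have comp: "(X *v b) $ i = X $ i \<bullet> b" for b i
    by (simp add: matrix_vector_mul_component)
  have "\<bar>(X *v v) $ i\<bar> \<le> R" for i
  proof -
    have "\<bar>X $ i \<bullet> v\<bar> \<le> norm (X $ i) * norm v" by (rule Cauchy_Schwarz_ineq2)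
    also have "\<dots> \<le> R * 1" using R R_pos v(1) by (intro mult_mono) auto
    finally show ?thesis by (simp add: comp)
  qed
  then show "norm_2_inf X \<le> R"
    unfolding v(2) infnorm_cart by (intro cSup_least) auto
  have "X *v u \<noteq> 0"
  proof
    assume "X *v u = 0"
    then have "X $ i \<bullet> u = 0" for i using comp[of u i] by simp
    then have "u \<bullet> z i = 0" for i by (simp add: inner_commute)
    with margin_u \<rho>_pos show False by (metis not_less)
  qed
  then have "0 < infnorm (X *v u)" by (simp add: infnorm_pos_lt)
  also have "\<dots> \<le> norm_2_inf X" using v u by simp
  finally show "0 < norm_2_inf X" .
qed

section \<open>Probability of a misclassification\<close>

text \<open>Every iterate is a nonnegative combination of the \<open>z j\<close>. This settles the
  data sets that the potential argument leaves out.\<close>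

lemma inner_nonneg_imp_correct:
  assumes "\<And>i j. 0 \<le> z i \<bullet> z j"
  shows "0 \<le> sgd X y \<alpha> j m \<bullet> z i"
proof (induction m)
  case (Suc m)
  then show ?case
    unfolding sgd_Suc sgd_step_def
    using assms \<alpha>_pos sgm_pos by (simp only: inner_add_left inner_scaleR_left) (simp add: less_imp_le)
qed simp

text \<open>Unless all inner products are nonnegative, two samples at an obtuse angle force
  \<open>n \<ge> 2\<close> and \<open>2 * \<rho>\<^sup>2 \<le> R\<^sup>2\<close>. Together with the
  assumption on \<open>k\<close> this makes the step size small enough for the potential, whose
  drift bounds the probability.\<close>

lemma prob_misclassification:
  assumes \<gamma>: "0 < \<gamma>" "\<gamma> \<le> 1"
    and q: "1.1 * (real CARD('n))\<^sup>2 * R\<^sup>2 < \<rho>\<^sup>2 * \<gamma> * sqrt (real k + 1)"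
  shows "measure M {\<omega> \<in> space M. \<exists>i. out \<omega> \<bullet> z i < 0} \<le> \<gamma>"
proof (cases "\<forall>i j. 0 \<le> z i \<bullet> z j")
  case True
  then have "0 \<le> out \<omega> \<bullet> z i" for \<omega> i
    unfolding output_B_def by (intro inner_nonneg_imp_correct) blast
  then have empty: "{\<omega> \<in> space M. \<exists>i. out \<omega> \<bullet> z i < 0} = {}"
    unfolding not_le[symmetric] by blast
  show ?thesis unfolding empty using \<gamma> by simp
next
  case False
  interpret prob_space M using run by (rule option_B_D)
  let ?n = "real CARD('n)"
  let ?W = "sqrt (real k + 1)"
  let ?bad = "\<lambda>b. \<exists>i. b \<bullet> z i < 0"
  obtain i j where ij: "z i \<bullet> z j < 0" using False by (auto simp: not_le)
  have "i \<noteq> j" using ij inner_ge_zero[of "z i"] by (metis not_less)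
  then have n: "2 \<le> CARD('n)"
    using card_mono[of UNIV "{i, j}"] by simp
  have W: "0 < ?W" "real k + 1 = ?W * ?W" by auto
  have \<rho>R: "2 * \<rho>\<^sup>2 \<le> R\<^sup>2"
  proof -
    \<comment> \<open>Both samples have margin at least \<rho> along \<open>u\<close>, while the
      negative inner product keeps the squared norm of their sum below
      \<open>2 * R\<^sup>2\<close>.\<close>
    have "2 * \<rho> \<le> u \<bullet> (z i + z j)"
      using margin_u[of i] margin_u[of j] by (simp add: inner_add_right)
    also have "\<dots> \<le> norm u * norm (z i + z j)" by (rule norm_cauchy_schwarz)
    also have "\<dots> \<le> 1 * norm (z i + z j)" using norm_u by (intro mult_right_mono) auto
    finally have "(2 * \<rho>)\<^sup>2 \<le> (norm (z i + z j))\<^sup>2" using \<rho>_pos by (intro power_mono) auto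
    also have "\<dots> \<le> 2 * R\<^sup>2"
      using ij norm_z_square[of i] norm_z_square[of j] unfolding square_norm_add by linarith
    finally show ?thesis by (simp add: power2_eq_square)
  qed
  have "\<rho>\<^sup>2 * \<gamma> * ?W \<le> \<rho>\<^sup>2 * 1 * ?W"
    using \<gamma> by (intro mult_right_mono mult_left_mono) auto
  also have "\<dots> = \<rho>\<^sup>2 * ?W" by simp
  finally have q': "1.1 * ?n\<^sup>2 * R\<^sup>2 < \<rho>\<^sup>2 * ?W" by (rule less_le_trans[OF q])
  have "2 * 2 \<le> ?n * ?n" using n by (intro mult_mono) auto
  then have n2: "4 \<le> ?n\<^sup>2" by (simp add: power2_eq_square)
  have "8.8 \<le> ?W"
  proof -
    \<comment> \<open>The constant 8.8 is 1.1 times \<open>n\<^sup>2 \<ge> 4\<close> times the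
      factor 2 between \<rho> squared and \<open>R\<^sup>2\<close>.\<close>
    have "1.1 * 4 * (2 * \<rho>\<^sup>2) \<le> 1.1 * ?n\<^sup>2 * R\<^sup>2"
      using n2 \<rho>R by (intro mult_mono) auto
    with q' have "1.1 * 4 * (2 * \<rho>\<^sup>2) < \<rho>\<^sup>2 * ?W" by (rule le_less_trans[rotated])
    then have "\<rho>\<^sup>2 * 8.8 < \<rho>\<^sup>2 * ?W" by simp
    then show ?thesis using \<rho>_pos by simp
  qed
  then have "ln 2 / ?W \<le> 0.6932 / 8.8" using ln2_bounds by (intro frac_le) auto
  also have "\<dots> \<le> (0.079 :: real)" by simp
  finally have small: "\<alpha> * R\<^sup>2 \<le> 0.079" unfolding \<alpha>_R by simp
  have noise: "\<alpha> * R ^ 4 * ?n \<le> 8 * 0.0394 * \<rho>\<^sup>2"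
  proof -
    \<comment> \<open>Only one factor of \<open>n\<^sup>2\<close> is replaced by its lower bound 2,
      whence 2.2; the other remains on the left.\<close>
    have "?n * R\<^sup>2 * (1.1 * 2) \<le> ?n * R\<^sup>2 * (1.1 * ?n)"
      using n by (intro mult_left_mono) auto
    also have "\<dots> = 1.1 * ?n\<^sup>2 * R\<^sup>2" by (simp add: power2_eq_square)
    also have "\<dots> \<le> \<rho>\<^sup>2 * ?W" using q' by simp
    finally have "?n * R\<^sup>2 / ?W \<le> \<rho>\<^sup>2 / 2.2" using W(1) by (simp add: field_simps)
    then have "ln 2 * (?n * R\<^sup>2 / ?W) \<le> 0.6932 * (\<rho>\<^sup>2 / 2.2)"
      using ln2_bounds W(1) by (intro mult_mono) auto
    also have "0.6932 * (\<rho>\<^sup>2 / 2.2) = 0.6932 / 2.2 * \<rho>\<^sup>2" by simp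
    also have "\<dots> \<le> 8 * 0.0394 * \<rho>\<^sup>2" by (intro mult_right_mono) auto
    also have "ln 2 * (?n * R\<^sup>2 / ?W) = \<alpha> * R ^ 4 * ?n"
      using R_pos W(1) by (simp add: \<alpha> field_simps power2_eq_square power4_eq_xxxx)
    finally show ?thesis .
  qed
  have noise': "\<alpha> * R ^ 3 * ?n \<le> 0.24 * \<rho>"
  proof -
    have "\<rho>\<^sup>2 \<le> 1 / 2 * R\<^sup>2" using \<rho>R by simp
    also have "\<dots> \<le> 0.75\<^sup>2 * R\<^sup>2" by (intro mult_right_mono) (auto simp: power2_eq_square)
    also have "\<dots> = (0.75 * R)\<^sup>2" by (simp only: power_mult_distrib)
    finally have "\<rho> \<le> 0.75 * R" by (rule power2_le_imp_le) (use R_pos in simp)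
    then have "0.32 * \<rho> * \<rho> \<le> 0.32 * \<rho> * (0.75 * R)" using \<rho>_pos by (intro mult_left_mono) auto
    moreover have "8 * 0.0394 * \<rho>\<^sup>2 \<le> 0.32 * \<rho> * \<rho>" by (simp add: power2_eq_square)
    ultimately have "R * (\<alpha> * R ^ 3 * ?n) \<le> R * (0.24 * \<rho>)"
      using noise by (simp add: power4_eq_xxxx power3_eq_cube ac_simps)
    then show ?thesis using R_pos by simp
  qed
  obtain V \<kappa> where \<kappa>: "0 < \<kappa>" and V: "\<And>b. 0 \<le> V b"
    and drift: "\<And>b. avg (\<lambda>j. V (sgd_step z \<alpha> b j)) \<le> V b - (if ?bad b then \<alpha> * \<kappa> else 0)"
    and V0: "V 0 \<le> \<kappa> * (1.1 * ln 2 * ?n\<^sup>2 / \<rho>\<^sup>2)"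
    by (rule misclassification_potential[OF n \<alpha>_pos small noise noise']) (rule that)
  have "(\<integral>\<omega>. (if ?bad (out \<omega>) then \<alpha> * \<kappa> else 0) \<partial>M) \<le> V 0 / (real k + 1)"
    using expectation_output_le[where V = V and e = 0 and h = "\<lambda>b. if ?bad b then \<alpha> * \<kappa> else 0"] V drift
    by (simp only: add_0_right)
  also have "(\<integral>\<omega>. (if ?bad (out \<omega>) then \<alpha> * \<kappa> else 0) \<partial>M)
      = (\<integral>\<omega>. \<alpha> * \<kappa> * indicator {\<omega> \<in> space M. ?bad (out \<omega>)} \<omega> \<partial>M)"
    by (intro Bochner_Integration.integral_cong) auto
  also have "\<dots> = \<alpha> * \<kappa> * prob {\<omega> \<in> space M. ?bad (out \<omega>)}"
    using sets_output_B[OF run, of ?bad] by simp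
  also have "V 0 / (real k + 1) \<le> \<alpha> * \<kappa> * \<gamma>"
  proof -
    have "1.1 * ?n\<^sup>2 * R\<^sup>2 / \<rho>\<^sup>2 \<le> \<gamma> * ?W"
      using q \<rho>_pos by (simp add: field_simps)
    then have "ln 2 * \<kappa> / R\<^sup>2 * (1.1 * ?n\<^sup>2 * R\<^sup>2 / \<rho>\<^sup>2) \<le> ln 2 * \<kappa> / R\<^sup>2 * (\<gamma> * ?W)"
      using \<kappa> by (intro mult_left_mono) auto
    moreover have "ln 2 * \<kappa> / R\<^sup>2 * (1.1 * ?n\<^sup>2 * R\<^sup>2 / \<rho>\<^sup>2) = \<kappa> * (1.1 * ln 2 * ?n\<^sup>2 / \<rho>\<^sup>2)"
      using R_pos by simp
    moreover have "ln 2 * \<kappa> / R\<^sup>2 * (\<gamma> * ?W) = \<alpha> * \<kappa> * \<gamma> * (?W * ?W)"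
    proof -
      have "ln 2 * \<kappa> / R\<^sup>2 * (\<gamma> * w) = ln 2 / (R\<^sup>2 * w) * \<kappa> * \<gamma> * (w * w)"
        if "0 < w" for w :: real
        using that R_pos by (simp add: field_simps)
      from this[OF W(1)] show ?thesis unfolding \<alpha> .
    qed
    ultimately have "V 0 \<le> \<alpha> * \<kappa> * \<gamma> * (real k + 1)"
      unfolding W(2)[symmetric] using V0 by linarith
    then show ?thesis by (simp add: field_simps)
  qed
  finally show ?thesis using \<alpha>_pos \<kappa> by simp
qed

section \<open>Margin of the normalized output\<close>

lemma less_margin_normalized_iff:
  "r < margin X y (normalized b) \<longleftrightarrow> (\<forall>i. r < (b \<bullet> z i) / norm b)"
  unfolding less_margin_iff normalized_def by (simp add: divide_inverse ac_simps)

text \<open>From \<open>\<rho> \<le> R\<close> the norm is at most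
  \<open>2 * (ln k + 1) / \<rho>\<close>, and dividing the nonnegative \<open>r\<close> by this
  larger number only makes it smaller.\<close>

lemma margin_normalized_gt:
  assumes r: "0 \<le> r" and m: "\<And>i. r < b \<bullet> z i"
    and norm: "norm b \<le> 2 * ln (real k) / \<rho> + 1 / R"
  shows "\<rho> * r / (2 * (ln (real k) + 1)) < margin X y (normalized b)"
  unfolding less_margin_normalized_iff
proof
  fix i
  have "b \<noteq> 0" using m[of i] r by auto
  then have b: "0 < norm b" by simp
  have "0 \<le> ln (real k)" using k by simp
  have "1 / R \<le> 2 / \<rho>" using \<rho>_pos \<rho>_le_R R_pos by (intro frac_le) auto
  then have "norm b \<le> 2 * (ln (real k) + 1) / \<rho>"
    using norm by (simp add: add_divide_distrib distrib_left)
  then have "r / (2 * (ln (real k) + 1) / \<rho>) \<le> r / norm b"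
    using r b \<rho>_pos \<open>0 \<le> ln (real k)\<close> by (intro divide_left_mono) auto
  also have "\<dots> < (b \<bullet> z i) / norm b"
    using m[of i] b by (rule divide_strict_right_mono)
  finally show "\<rho> * r / (2 * (ln (real k) + 1)) < (b \<bullet> z i) / norm b"
    by (simp add: mult.commute)
qed

text \<open>A small gradient forces every sigmoid below \<open>1 / q\<close>, which inverts to
  \<open>exp (b \<bullet> z i) > q - 1\<close>.\<close>

lemma margin_gt_if_small_gradient:
  assumes q: "1 < q" and G: "(norm (loss_grad z b))\<^sup>2 < (\<rho> / (real CARD('n) * q))\<^sup>2"
  shows "ln (q - 1) < b \<bullet> z i"
proof -
  let ?n = "real CARD('n)"
  have "norm (loss_grad z b) < \<rho> / (?n * q)"
    using G by (rule power2_less_imp_less) (use \<rho>_pos q in simp)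
  then have "\<rho> * sgm (b \<bullet> z i) / ?n < \<rho> / (?n * q)"
    using norm_loss_grad_ge_sgm[of b i] by linarith
  then have "sgm (b \<bullet> z i) < 1 / q"
    using \<rho>_pos q by (simp add: field_simps)
  then have "q < 1 + exp (b \<bullet> z i)"
    using q by (simp add: sgm_def field_simps)
  then have "ln (q - 1) < ln (exp (b \<bullet> z i))"
    using q by (subst ln_less_cancel_iff) auto
  then show ?thesis by simp
qed

text \<open>The cases follow the sign of the logarithm: for \<open>q \<le> 1\<close> the bound is
  minus infinity, for \<open>1 < q < 2\<close> it is negative and correct classification suffices,
  and for \<open>q \<ge> 2\<close> Markov's inequality for the gradient applies.\<close>

lemma prob_margin:
  assumes \<gamma>: "0 < \<gamma>" "\<gamma> \<le> 1"
  defines "q \<equiv> \<rho> * sqrt \<gamma> * root 4 (real k + 1) / (real CARD('n) * R * sqrt 1.1)"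
  shows "1 - \<gamma> \<le> measure M {\<omega> \<in> space M. ereal (margin X y (normalized (out \<omega>)))
    > ereal \<rho> * eln (q - 1) / ereal (2 * (ln (real k) + 1))}" (is "_ \<le> measure M ?S")
proof -
  interpret prob_space M using run by (rule option_B_D)
  let ?n = "real CARD('n)"
  let ?W = "sqrt (real k + 1)"
  have lnk: "0 \<le> ln (real k)" using k by simp
  have W: "0 < ?W" by simp
  have S: "?S \<in> events" by (rule sets_output_B[OF run])
  have root: "(root 4 (real k + 1))\<^sup>2 = ?W"
  proof -
    have "root 4 (real k + 1) = root 2 (root 2 (real k + 1))"
      unfolding real_root_mult_exp[symmetric] by simp
    then show ?thesis by (simp add: sqrt_def[symmetric])
  qed
  have q2: "q\<^sup>2 = \<rho>\<^sup>2 * \<gamma> * ?W / (1.1 * ?n\<^sup>2 * R\<^sup>2)"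
    using \<gamma> unfolding q_def by (simp add: power_divide power_mult_distrib root)
  consider "q \<le> 1" | "1 < q" "q < 2" | "2 \<le> q" by linarith
  then show ?thesis
  proof cases
    case 1
    then have "ereal \<rho> * eln (q - 1) / ereal (2 * (ln (real k) + 1)) = - \<infinity>"
      using \<rho>_pos lnk by (simp add: eln_def)
    then have "?S = space M" by auto
    then show ?thesis using \<gamma> by (simp add: prob_space)
  next
    case 2
    define bad where "bad = {\<omega> \<in> space M. \<exists>i. out \<omega> \<bullet> z i < 0}"
    have "1\<^sup>2 < q\<^sup>2" using 2 by (intro power_strict_mono) auto
    then have "1.1 * ?n\<^sup>2 * R\<^sup>2 < \<rho>\<^sup>2 * \<gamma> * ?W"
      unfolding q2 using R_pos by (simp add: field_simps)
    from prob_misclassification[OF \<gamma> this] have "prob bad \<le> \<gamma>" unfolding bad_def .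
    moreover have bad: "bad \<in> events"
      unfolding bad_def by (rule sets_output_B[OF run])
    ultimately have "1 - \<gamma> \<le> prob (space M - bad)" by (simp add: prob_compl)
    also have "\<dots> \<le> prob ?S"
    proof (rule finite_measure_mono[OF _ S], rule subsetI)
      fix \<omega> assume \<omega>: "\<omega> \<in> space M - bad"
      let ?r = "\<rho> * ln (q - 1) / (2 * (ln (real k) + 1))"
      have "ln (q - 1) < 0" using 2 by simp
      then have r: "?r < 0"
        using \<rho>_pos lnk by (intro divide_neg_pos mult_pos_neg) auto
      have "0 \<le> out \<omega> \<bullet> z i" for i
        using \<omega> unfolding bad_def not_less[symmetric] by blast
      \<comment> \<open>This includes a zero output: the quotient is then \<open>0 / 0 = 0\<close>,
        in accordance with its normalization being zero.\<close>
      then have "?r < (out \<omega> \<bullet> z i) / norm (out \<omega>)" for i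
        using r divide_nonneg_nonneg[OF _ norm_ge_zero] less_le_trans by blast
      then have "?r < margin X y (normalized (out \<omega>))"
        unfolding less_margin_normalized_iff by blast
      then show "\<omega> \<in> ?S"
        using \<omega> 2 lnk by (simp add: eln_def)
    qed
    finally show ?thesis .
  next
    case 3
    \<comment> \<open>The Markov threshold that is exceeded with probability at most \<gamma>; it
      equals the square of \<open>\<rho> / (n * q)\<close>, which explains the form of
      \<open>q\<close>.\<close>
    define c where "c = 1.1 * R\<^sup>2 / (?W * \<gamma>)"
    define big where "big = {\<omega> \<in> space M. c \<le> (norm (loss_grad z (out \<omega>)))\<^sup>2}"
    have c: "0 < c" unfolding c_def using \<gamma> W R_pos by (intro divide_pos_pos mult_pos_pos) auto
    have big: "big \<in> events"
      unfolding big_def by (rule sets_output_B[OF run])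
    have "prob big \<le> expectation (\<lambda>\<omega>. (norm (loss_grad z (out \<omega>)))\<^sup>2) / c"
      unfolding big_def using c integrable_output_B[OF run, of "\<lambda>b. (norm (loss_grad z b))\<^sup>2"]
      by (intro integral_Markov_inequality_measure[where A = "space M"]) auto
    also have "\<dots> \<le> (1.1 * R\<^sup>2 / ?W) / c"
      using c expectation_gradient by (intro divide_right_mono) auto
    also have "\<dots> = \<gamma>" unfolding c_def using \<gamma> W R_pos by (simp add: field_simps)
    finally have "1 - \<gamma> \<le> prob (space M - big)" using big by (simp add: prob_compl)
    also have "\<dots> \<le> prob ?S"
    proof (rule finite_measure_mono[OF _ S], rule subsetI)
      fix \<omega> assume \<omega>: "\<omega> \<in> space M - big"
      have "c = (\<rho> / (?n * q))\<^sup>2"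
        unfolding c_def power_divide power_mult_distrib q2
        using \<rho>_pos R_pos \<gamma> W by (simp add: field_simps)
      then have "(norm (loss_grad z (out \<omega>)))\<^sup>2 < (\<rho> / (?n * q))\<^sup>2"
        using \<omega> by (auto simp: big_def not_le)
      then have "ln (q - 1) < out \<omega> \<bullet> z i" for i
        using 3 by (intro margin_gt_if_small_gradient) auto
      then have "\<rho> * ln (q - 1) / (2 * (ln (real k) + 1)) < margin X y (normalized (out \<omega>))"
        using 3 \<omega> norm_out_le by (intro margin_normalized_gt) auto
      then show "\<omega> \<in> ?S"
        using \<omega> 3 lnk by (simp add: eln_def)
    qed
    finally show ?thesis .
  qed
qed

end

theorem theorem4p3:
  fixes X :: "real ^ 'p ^ 'n"
    and y :: "'n \<Rightarrow> real"
    and R \<alpha> :: real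
    and k :: nat
    and M :: "'w measure"
    and J :: "nat \<Rightarrow> 'w \<Rightarrow> 'n"
    and I :: "'w \<Rightarrow> nat"
  assumes labels: "\<And>i. y i \<in> {-1, 1}"
    and R: "\<And>i. norm (X $ i) \<le> R"
    and sep: "separable X y"
    and k: "k \<ge> 1"
    and \<alpha>: "\<alpha> = ln 2 / (R\<^sup>2 * sqrt (real k + 1))"
    and run: "option_B M X y \<alpha> k J I"
  shows
    "(\<forall>\<gamma>. 0 < \<gamma> \<and> \<gamma> \<le> 1 \<longrightarrow>
        measure M {\<omega> \<in> space M.
          ereal (margin X y (normalized (output_B X y \<alpha> J I \<omega>)))
            > ereal (deg_sep X y)
                * eln (deg_sep X y * sqrt \<gamma> * root 4 (real k + 1)
                         / (real CARD('n) * R * sqrt 1.1) - 1)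
                / ereal (2 * (ln (real k) + 1))}
          \<ge> 1 - \<gamma>)
     \<and> (\<forall>\<omega> \<in> space M.
          norm (output_B X y \<alpha> J I \<omega>)
            \<le> 2 * ln (real k) / deg_sep X y + 2 / norm_2_inf X)
     \<and> integrable M (\<lambda>\<omega>. (norm (grad (logistic_loss X y) (output_B X y \<alpha> J I \<omega>)))\<^sup>2)
     \<and> (\<integral>\<omega>. (norm (grad (logistic_loss X y) (output_B X y \<alpha> J I \<omega>)))\<^sup>2 \<partial>M)
          < 1.1 * R\<^sup>2 / sqrt (real k + 1)"
proof -
  interpret sgd_run X y R \<alpha> k M J I
    by unfold_locales (fact labels R sep k \<alpha> run)+
  \<comment> \<open>The path bound has \<open>1 / R\<close> as its additive term, so even
    \<open>1 / norm_2_inf X\<close> would be covered; the factor 2 is slack.\<close>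
  have "1 / R \<le> 2 / norm_2_inf X"
    using norm_2_inf_bounds by (intro frac_le) auto
  then have "norm (out \<omega>) \<le> 2 * ln (real k) / \<rho> + 2 / norm_2_inf X" if "\<omega> \<in> space M" for \<omega>
    using norm_out_le[OF that] by linarith
  then show ?thesis
    unfolding grad_logistic_loss
    using prob_margin expectation_gradient
      integrable_output_B[OF run, of "\<lambda>b. (norm (loss_grad z b))\<^sup>2"]
    by blast
qed

end
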